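(* Let $n>2$, let $\gamma\in(0,1)$, and let $\Omega$ be an open subset of $\mathbb{R}^n$. If $1<p\le n$, there exist two positive constants $K_1(\gamma,n,p)$ and $K_2(\gamma,n,p)$ that depend only on $\gamma,n,p$ such that $$K_1(\gamma,n,p)\,r_{\Omega,\gamma}^{-p}\ \le\ \lambda_{1,p}(\Omega)\ \le\ K_2(\gamma,n,p)\,r_{\Omega,\gamma}^{-p},$$ where $r_{\Omega,\gamma}$ is the interior $p$-capacity radius of $\Omega$.
   Context: No boundedness or boundary smoothness of $\Omega$ is assumed. The bottom of the spectrum of $-\Delta_p$ on $\Omega$, where $\Delta_p f=\operatorname{div}(|\nabla f|^{p-2}\nabla f)$, is $$\lambda_{1,p}(\Omega)=\inf_{0\ne u\in C_0^\infty(\Omega)}\frac{\int_\Omega|\nabla u|^p\,dx}{\int_\Omega|u|^p\,dx}.$$ The $p$-capacity of a compact set $F$ is $\operatorname{cap}_p(F)=\inf\left\{\int_{\mathbb{R}^n}|\nabla u|^p\,dx: u\in C_0^\infty(\mathbb{R}^n),\ u|_F\ge1\right\}$. For $\gamma\in(0,1)$, a compact subset $F$ of a closed ball $\overline{B}_r$ of radius $r$ is called $(p,\gamma)$-negligible if $\operatorname{cap}_p(F)\le\gamma\operatorname{cap}_p(\overline{B}_r)$. The interior $p$-capacity radius is $$r_{\Omega,\gamma}=\sup\{r:\text{ there is a ball } B_r \text{ of radius } r \text{ such that } \overline{B}_r\setminus\Omega \text{ is } (p,\gamma)\text{-negligible}\},$$ which may be $+\infty$, in which case $r_{\Omega,\gamma}^{-p}$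 is read as $0$.
   Formalization: For p=n, where cap_n over C_0^∞(R^n) vanishes on all compact sets and the upper bound fails (e.g. for a ball), negligibility in the closed ball of radius r is instead defined by capacity relative to the concentric open ball of radius 2r (test functions supported there). *)

theory Defs
  imports "HOL-Analysis.Analysis"
begin

definition grad :: "(real^'n \<Rightarrow> real) \<Rightarrow> real^'n \<Rightarrow> real^'n" where
  "grad u x = (\<chi> i. frechet_derivative u (at x) (axis i 1))"

primrec Ck :: "nat \<Rightarrow> (real^'n \<Rightarrow> real) \<Rightarrow> bool" where
  "Ck 0 u \<longleftrightarrow> continuous_on UNIV u"
| "Ck (Suc k) u \<longleftrightarrow> (\<forall>x. u differentiable (at x)) \<and> (\<forall>i. Ck k (\<lambda>x. grad u x $ i))"

(* C_0^infinity(D): a function on D is identified with its extension by zero to the whole space. *)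
definition test_fun :: "(real^'n) set \<Rightarrow> (real^'n \<Rightarrow> real) set" where
  "test_fun D = {u. (\<forall>k. Ck k u) \<and> compact (closure {x. u x \<noteq> 0}) \<and> closure {x. u x \<noteq> 0} \<subseteq> D}"

(* Inf {} = top, so the value is top for the empty set. *)
definition lambda1 :: "real \<Rightarrow> (real^'n) set \<Rightarrow> ennreal" where
  "lambda1 p \<Omega> = (INF u \<in> {u \<in> test_fun \<Omega>. u \<noteq> (\<lambda>_. 0)}.
     (\<integral>\<^sup>+x\<in>\<Omega>. ennreal (norm (grad u x) powr p) \<partial>lborel) / (\<integral>\<^sup>+x\<in>\<Omega>. ennreal (\<bar>u x\<bar> powr p) \<partial>lborel))"

definition p_capacity_in :: "(real^'n) set \<Rightarrow> real \<Rightarrow> (real^'n) set \<Rightarrow> ennreal" where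
  "p_capacity_in D p F = (INF u \<in> {u \<in> test_fun D. \<forall>x\<in>F. u x \<ge> 1}.
     (\<integral>\<^sup>+x. ennreal (norm (grad u x) powr p) \<partial>lborel))"

abbreviation p_capacity :: "real \<Rightarrow> (real^'n) set \<Rightarrow> ennreal" where
  "p_capacity \<equiv> p_capacity_in UNIV"

(* For p < n this is the capacity with respect to the whole space. For p = n that capacity
   vanishes on every compact set, so every set would be negligible in every ball; as is
   standard in the conformal case, the capacity of subsets of the closed ball of radius r is
   then taken relative to the concentric open ball of radius 2r. *)
definition ball_capacity :: "real \<Rightarrow> real^'n \<Rightarrow> real \<Rightarrow> (real^'n) set \<Rightarrow> ennreal" where
  "ball_capacity p c r F =
     (if p < real CARD('n) then p_capacity p F else p_capacity_in (ball c (2 * r)) p F)"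

definition negligible_in :: "real \<Rightarrow> real \<Rightarrow> real^'n \<Rightarrow> real \<Rightarrow> (real^'n) set \<Rightarrow> bool" where
  "negligible_in p \<gamma> c r F \<longleftrightarrow> compact F \<and> F \<subseteq> cball c r \<and>
     ball_capacity p c r F \<le> ennreal \<gamma> * ball_capacity p c r (cball c r)"

definition capacity_radius :: "real \<Rightarrow> real \<Rightarrow> (real^'n) set \<Rightarrow> ennreal" where
  "capacity_radius p \<gamma> \<Omega> =
     Sup {ennreal r |r. 0 < r \<and> (\<exists>c. negligible_in p \<gamma> c r (cball c r - \<Omega>))}"

(* r^(-p) for an extended radius: 0 at infinity, and infinity at 0 (inverse 0 = top). *)
definition neg_power :: "ennreal \<Rightarrow> real \<Rightarrow> ennreal" where
  "neg_power r p = (if r = top then 0 else inverse (ennreal (enn2real r powr p)))"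

end

(*
  Both bounds are proved after scaling the ball to unit radius; write E(u) for the p-energy.

  Lower bound.  If cball c r - Omega is not negligible for any c, then for a test function u on
  Omega and a cutoff theta the function theta(y) (1 - u(c + r y) / u(c)) competes for the capacity
  of that set.  This bounds |u(c)|^p by local integrals of |u(c + r y) - u(c)|^p and of
  |grad u(c + r y)|^p.  Integrating over c, the first is controlled by
  int |u(x + h) - u(x)|^p dx <= (2 |h|)^p E(u), and one obtains a Poincare inequality with
  constant r^p.  It is non-degenerate because the unit ball has positive capacity.

  Upper bound.  If F = cball 0 1 - Omega is negligible, a smooth truncation w of an almost optimal
  competitor for F satisfies 0 <= w <= 1, w = 1 near F and E(w) <= q cap(cball 0 1) with q < 1.
  A cutoff times 1 - w is then a test function on Omega of bounded energy.  Its L^p norm is bounded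
  below: if 1 - w were small in L^p on a ball slightly smaller than the unit ball, a further cutoff
  would turn w, at little cost in energy, into a competitor for a slightly smaller concentric ball,
  whose capacity is close to that of the unit ball (by a diffeomorphism close to the identity).
*)

theory Submission
  imports Defs
begin

text \<open>In the lower bound such constants are harmless and crude factors like 2^p are accepted.
  In the upper bound they would spoil q < 1: every loss there is a power of \<open>1 + e\<close>,
  and the gap between \<gamma> and 1 pays for all of them. The smaller ball enters because nothing
  is known about \<Omega> outside the unit ball: the test function must be supported inside it, so a
  deficit \<open>1 - w\<close> concentrated near the unit sphere would be lost. The near equality of
  the capacities of the two balls rules this out. Hoelder's inequality is replaced by Young's
  inequality with a free threshold followed by absorption. All cutoffs are fixed before \<Omega>,
  hence the constants depend only on \<gamma>, n, p. The cases p < n and p = n differ only in the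
  proof that the unit ball has positive capacity: for p = n competitors vanish outside the ball of
  radius 2, for p < n integrability along rays is used.\<close>

section \<open>Calculus of the gradient\<close>

lemma frechet_derivative_grad:
  assumes "u differentiable (at x)"
  shows "(u has_derivative (\<lambda>h. grad u x \<bullet> h)) (at x)"
proof -
  let ?D = "frechet_derivative u (at x)"
  have D: "(u has_derivative ?D) (at x)"
    using assms frechet_derivative_works by blast
  then have lin: "linear ?D"
    by (rule has_derivative_linear)
  have "?D h = grad u x \<bullet> h" for h
  proof -
    have "?D h = ?D (\<Sum>i\<in>UNIV. (h $ i) *s axis i 1)"
      by (simp add: basis_expansion)
    also have "\<dots> = (\<Sum>i\<in>UNIV. h $ i * ?D (axis i 1))"
      by (simp add: linear_sum[OF lin] linear_scale[OF lin] scalar_mult_eq_scaleR)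
    also have "\<dots> = grad u x \<bullet> h"
      by (simp add: grad_def inner_vec_def mult.commute)
    finally show ?thesis .
  qed
  then have "?D = (\<lambda>h. grad u x \<bullet> h)" by blast
  with D show ?thesis by simp
qed

lemma grad_eqI:
  assumes "(u has_derivative (\<lambda>h. g \<bullet> h)) (at x)"
  shows "grad u x = g"
proof -
  have "frechet_derivative u (at x) = (\<lambda>h. g \<bullet> h)"
    using assms by (metis frechet_derivative_at)
  then show ?thesis
    by (simp add: grad_def vec_eq_iff inner_axis)
qed

lemma grad_const [simp]: "grad (\<lambda>_. c) x = 0"
  by (rule grad_eqI) simp

lemma grad_add:
  assumes "u differentiable (at x)" "v differentiable (at x)"
  shows "grad (\<lambda>x. u x + v x) x = grad u x + grad v x"
  by (rule grad_eqI)
     (use has_derivative_add[OF assms[THEN frechet_derivative_grad]] in \<open>simp add: inner_add_left\<close>)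

lemma grad_mult:
  assumes "u differentiable (at x)" "v differentiable (at x)"
  shows "grad (\<lambda>x. u x * v x) x = u x *\<^sub>R grad v x + v x *\<^sub>R grad u x"
  by (rule grad_eqI)
     (use has_derivative_mult[OF assms[THEN frechet_derivative_grad]] in
       \<open>simp add: inner_add_left mult.commute\<close>)

lemma grad_cong_open:
  assumes "open S" "x \<in> S" "\<And>y. y \<in> S \<Longrightarrow> u y = v y" "v differentiable (at x)"
  shows "grad u x = grad v x"
proof (rule grad_eqI)
  show "(u has_derivative (\<lambda>h. grad v x \<bullet> h)) (at x)"
    using has_derivative_transform_within_open[OF frechet_derivative_grad[OF assms(4)] assms(1,2)] assms(3)
    by metis
qed

lemma has_derivative_vecI:
  fixes T :: "real^'m \<Rightarrow> real^'n"
  assumes "\<And>j. (\<lambda>x. T x $ j) differentiable (at x)"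
  shows "(T has_derivative (\<lambda>h. \<chi> j. grad (\<lambda>x. T x $ j) x \<bullet> h)) (at x)"
proof -
  have "((\<lambda>x. T x \<bullet> b) has_derivative (\<lambda>h. (\<chi> j. grad (\<lambda>x. T x $ j) x \<bullet> h) \<bullet> b)) (at x)"
    if "b \<in> Basis" for b
    using that frechet_derivative_grad[OF assms] by (auto simp: Basis_vec_def inner_axis)
  then show ?thesis
    using has_derivative_componentwise_within by blast
qed

lemma grad_compose:
  fixes T :: "real^'m \<Rightarrow> real^'n"
  assumes "u differentiable (at (T x))" "\<And>j. (\<lambda>x. T x $ j) differentiable (at x)"
  shows "grad (\<lambda>x. u (T x)) x = (\<Sum>j\<in>UNIV. (grad u (T x) $ j) *\<^sub>R grad (\<lambda>x. T x $ j) x)"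
    and "(\<lambda>x. u (T x)) differentiable (at x)"
proof -
  have "((\<lambda>x. u (T x)) has_derivative
      (\<lambda>h. grad u (T x) \<bullet> (\<chi> j. grad (\<lambda>x. T x $ j) x \<bullet> h))) (at x)"
    using has_derivative_compose[OF has_derivative_vecI[OF assms(2)] frechet_derivative_grad[OF assms(1)]] .
  also have "(\<lambda>h. grad u (T x) \<bullet> (\<chi> j. grad (\<lambda>x. T x $ j) x \<bullet> h)) =
     (\<lambda>h. (\<Sum>j\<in>UNIV. (grad u (T x) $ j) *\<^sub>R grad (\<lambda>x. T x $ j) x) \<bullet> h)"
    unfolding inner_vec_def[of "grad u (T x)"] by (simp add: inner_sum_left)
  finally have *: "((\<lambda>x. u (T x)) has_derivative
     (\<lambda>h. (\<Sum>j\<in>UNIV. (grad u (T x) $ j) *\<^sub>R grad (\<lambda>x. T x $ j) x) \<bullet> h)) (at x)" .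
  show "grad (\<lambda>x. u (T x)) x = (\<Sum>j\<in>UNIV. (grad u (T x) $ j) *\<^sub>R grad (\<lambda>x. T x $ j) x)"
    by (rule grad_eqI[OF *])
  show "(\<lambda>x. u (T x)) differentiable (at x)"
    using * by (rule differentiableI)
qed

lemma grad_compose_real:
  assumes "(f has_real_derivative d) (at (u x))" "u differentiable (at x)"
  shows "grad (\<lambda>x. f (u x)) x = d *\<^sub>R grad u x"
    and "(\<lambda>x. f (u x)) differentiable (at x)"
proof -
  have "(f has_derivative (\<lambda>h. d * h)) (at (u x))"
    using assms(1) by (simp add: has_field_derivative_def)
  from has_derivative_compose[OF frechet_derivative_grad[OF assms(2)] this]
  have *: "((\<lambda>x. f (u x)) has_derivative (\<lambda>h. (d *\<^sub>R grad u x) \<bullet> h)) (at x)"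
    by simp
  show "grad (\<lambda>x. f (u x)) x = d *\<^sub>R grad u x"
    by (rule grad_eqI[OF *])
  show "(\<lambda>x. f (u x)) differentiable (at x)"
    using * by (rule differentiableI)
qed

section \<open>Functions of class C^k\<close>

lemma Ck_Suc_differentiable: "Ck (Suc k) u \<Longrightarrow> u differentiable (at x)"
  by simp

text \<open>The recursion for \<open>Ck\<close> does not mention lower orders, so the inclusion
  needs an induction that starts from differentiable implies continuous. Product and chain rules
  rely on it for the factors left undifferentiated.\<close>

lemma Ck_SucD: "Ck (Suc k) u \<Longrightarrow> Ck k u"
proof (induction k arbitrary: u)
  case 0
  then show ?case
    by (auto intro!: differentiable_imp_continuous_on simp: differentiable_on_def
        intro: differentiable_at_withinI)
next
  case (Suc k)
  then show ?case
    by (metis Ck.simps(2))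
qed

lemma Ck_const [simp]: "Ck k (\<lambda>_. c)"
  by (induction k arbitrary: c) auto

lemma Ck_add: "Ck k u \<Longrightarrow> Ck k v \<Longrightarrow> Ck k (\<lambda>x. u x + v x)"
proof (induction k arbitrary: u v)
  case 0
  then show ?case by (auto intro: continuous_on_add)
next
  case (Suc k)
  then show ?case
    by (auto simp: grad_add)
qed

lemma Ck_mult: "Ck k u \<Longrightarrow> Ck k v \<Longrightarrow> Ck k (\<lambda>x. u x * v x)"
proof (induction k arbitrary: u v)
  case 0
  then show ?case by (auto intro: continuous_on_mult)
next
  case (Suc k)
  have "Ck k u" "Ck k v"
    using Suc.prems Ck_SucD by blast+
  then show ?case
    using Suc.prems by (auto simp: grad_mult intro!: Ck_add Suc.IH)
qed

lemma Ck_sum: "finite I \<Longrightarrow> (\<And>i. i \<in> I \<Longrightarrow> Ck k (u i)) \<Longrightarrow> Ck k (\<lambda>x. \<Sum>i\<in>I. u i x)"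
  by (induction I rule: finite_induct) (auto intro: Ck_add)

lemma Ck_component: "Ck k (\<lambda>x::real^'n. x $ i)"
proof (cases k)
  case 0
  then show ?thesis by (simp add: continuous_on_component continuous_on_id)
next
  case (Suc m)
  have *: "((\<lambda>x::real^'n. x $ i) has_derivative (\<lambda>h. axis i 1 \<bullet> h)) (at x)" for x
    using bounded_linear.has_derivative[OF bounded_linear_vec_nth has_derivative_ident]
    by (simp add: inner_axis')
  then have "grad (\<lambda>x::real^'n. x $ i) x = axis i 1" for x
    by (rule grad_eqI)
  then show ?thesis
    using * by (auto simp: Suc intro: differentiableI)
qed

text \<open>By the chain rule a partial derivative is a sum of products of partials of
  \<open>u\<close> composed with \<open>T\<close> and partials of the components of
  \<open>T\<close>. The induction hypothesis is applied to the partials of \<open>u\<close>, so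
  \<open>u\<close> is generalized and \<open>T\<close> stays fixed.\<close>

lemma Ck_compose:
  fixes T :: "real^'m \<Rightarrow> real^'n"
  assumes "Ck k u" "\<And>j. Ck k (\<lambda>x. T x $ j)"
  shows "Ck k (\<lambda>x. u (T x))"
  using assms
proof (induction k arbitrary: u)
  case 0
  have "continuous_on UNIV (\<lambda>x. \<chi> j. T x $ j)"
    using 0 by (intro continuous_on_vec_lambda) simp
  then have "continuous_on UNIV T" by simp
  then show ?case
    using 0 by (auto intro: continuous_on_compose2)
next
  case (Suc k)
  have d: "u differentiable at y" "(\<lambda>x. T x $ j) differentiable at x" for y x j
    using Suc.prems by auto
  have T: "Ck k (\<lambda>x. T x $ j)" for j
    using Suc.prems(2) Ck_SucD by blast
  have u: "Ck k (\<lambda>x. grad u (T x) $ j)" for j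
    using Suc.prems(1) T Suc.IH by auto
  have "Ck k (\<lambda>x. grad (\<lambda>x. u (T x)) x $ i)" for i
    unfolding grad_compose(1)[OF d]
    using Suc.prems(2) by (auto simp: sum_component intro!: Ck_sum Ck_mult u)
  then show ?case
    using grad_compose(2)[OF d] by simp
qed

section \<open>Smooth functions of one real variable\<close>

text \<open>The derivative is existentially quantified so that explicit formulas can be supplied as
  witnesses.\<close>

primrec Ck1 :: "nat \<Rightarrow> (real \<Rightarrow> real) \<Rightarrow> bool" where
  "Ck1 0 f \<longleftrightarrow> continuous_on UNIV f"
| "Ck1 (Suc k) f \<longleftrightarrow> (\<exists>f'. (\<forall>t. (f has_real_derivative f' t) (at t)) \<and> Ck1 k f')"

lemma Ck1_SucD: "Ck1 (Suc k) f \<Longrightarrow> Ck1 k f"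
proof (induction k arbitrary: f)
  case 0
  then show ?case
    by (auto intro!: DERIV_isCont simp: continuous_on_eq_continuous_at)
next
  case (Suc k)
  then obtain f' where "\<forall>t. (f has_real_derivative f' t) (at t)" "Ck1 (Suc k) f'"
    by auto
  with Suc.IH[of f'] show ?case by auto
qed

lemma Ck_compose_real: "Ck1 k f \<Longrightarrow> Ck k u \<Longrightarrow> Ck k (\<lambda>x. f (u x))"
proof (induction k arbitrary: f u)
  case 0
  then show ?case by (auto intro: continuous_on_compose2)
next
  case (Suc k)
  then obtain f' where f': "\<And>t. (f has_real_derivative f' t) (at t)" "Ck1 k f'"
    by auto
  have u: "u differentiable at x" for x
    using Suc.prems by auto
  have "Ck k (\<lambda>x. f' (u x))"
    using Suc.IH[OF f'(2) Ck_SucD[OF Suc.prems(2)]] .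
  then have "Ck k (\<lambda>x. f' (u x) * grad u x $ i)" for i
    using Suc.prems(2) by (simp add: Ck_mult)
  then show ?case
    by (simp add: grad_compose_real[OF f'(1) u])
qed

lemma Ck1_const [simp]: "Ck1 k (\<lambda>_. c)"
  by (induction k arbitrary: c) (auto intro!: exI[of _ "\<lambda>_. 0"])

lemma Ck1_add: "Ck1 k f \<Longrightarrow> Ck1 k g \<Longrightarrow> Ck1 k (\<lambda>t. f t + g t)"
proof (induction k arbitrary: f g)
  case 0
  then show ?case by (auto intro: continuous_on_add)
next
  case (Suc k)
  then obtain f' g' where "\<And>t. (f has_real_derivative f' t) (at t)" "Ck1 k f'"
    "\<And>t. (g has_real_derivative g' t) (at t)" "Ck1 k g'"
    by auto
  with Suc.IH[of f' g'] show ?case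
    unfolding Ck1.simps by (intro exI[of _ "\<lambda>t. f' t + g' t"] conjI allI DERIV_add)
qed

lemma Ck1_mult: "Ck1 k f \<Longrightarrow> Ck1 k g \<Longrightarrow> Ck1 k (\<lambda>t. f t * g t)"
proof (induction k arbitrary: f g)
  case 0
  then show ?case by (auto intro: continuous_on_mult)
next
  case (Suc k)
  then obtain f' g' where *: "\<And>t. (f has_real_derivative f' t) (at t)" "Ck1 k f'"
    "\<And>t. (g has_real_derivative g' t) (at t)" "Ck1 k g'"
    by auto
  have "Ck1 k (\<lambda>t. f' t * g t + g' t * f t)"
    using Suc.prems[THEN Ck1_SucD] * by (intro Ck1_add Suc.IH)
  with * show ?case
    unfolding Ck1.simps by (intro exI[of _ "\<lambda>t. f' t * g t + g' t * f t"] conjI allI DERIV_mult)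
qed

lemma Ck1_compose: "Ck1 k f \<Longrightarrow> Ck1 k g \<Longrightarrow> Ck1 k (\<lambda>t. f (g t))"
proof (induction k arbitrary: f g)
  case 0
  then show ?case by (auto intro: continuous_on_compose2)
next
  case (Suc k)
  then obtain f' g' where *: "\<And>t. (f has_real_derivative f' t) (at t)" "Ck1 k f'"
    "\<And>t. (g has_real_derivative g' t) (at t)" "Ck1 k g'"
    by auto
  have "Ck1 k (\<lambda>t. f' (g t) * g' t)"
    by (rule Ck1_mult[OF Suc.IH[OF *(2) Ck1_SucD[OF Suc.prems(2)]] *(4)])
  with * show ?case
    unfolding Ck1.simps by (intro exI[of _ "\<lambda>t. f' (g t) * g' t"] conjI allI DERIV_chain2)
qed

lemma Ck1_ident: "Ck1 k (\<lambda>t. t)"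
proof (cases k)
  case (Suc m)
  then show ?thesis by (auto intro!: exI[of _ "\<lambda>_. 1"])
qed (simp add: continuous_on_id)

text \<open>The derivative is a product of \<open>f'\<close> and two copies of the reciprocal
  itself, so the induction hypothesis for the reciprocal already gives its regularity.\<close>

lemma Ck1_inverse:
  assumes "\<And>t. f t \<noteq> 0" "Ck1 k f"
  shows "Ck1 k (\<lambda>t. inverse (f t))"
  using assms(2)
proof (induction k)
  case 0
  then show ?case using assms(1) by (auto intro: continuous_on_inverse)
next
  case (Suc k)
  from Suc.prems obtain f' where f': "\<And>t. (f has_real_derivative f' t) (at t)" "Ck1 k f'"
    by auto
  have i: "Ck1 k (\<lambda>t. inverse (f t))"
    using Suc Ck1_SucD by blast
  have "Ck1 k (\<lambda>t. (-1) * (inverse (f t) * f' t * inverse (f t)))"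
    using i f' by (intro Ck1_mult) auto
  moreover have "((\<lambda>t. inverse (f t)) has_real_derivative
      (-1) * (inverse (f t) * f' t * inverse (f t))) (at t)" for t
    using DERIV_inverse'[OF f'(1) assms(1)] by simp
  ultimately show ?case
    unfolding Ck1.simps
    by (intro exI[of _ "\<lambda>t. (-1) * (inverse (f t) * f' t * inverse (f t))"] conjI allI)
qed

text \<open>The functions $t^{-m} e^{-1/t}$ (extended by $0$) have derivatives in the span of the same
  family, which gives their smoothness by induction on the order.\<close>

definition flat :: "nat \<Rightarrow> real \<Rightarrow> real" where
  "flat m t = (if t \<le> 0 then 0 else inverse t ^ m * exp (- inverse t))"

text \<open>With s = 1/t this is the decay of s^m / exp s at infinity.\<close>

lemma flat_tendsto_0: "(flat m \<longlongrightarrow> 0) (at_right 0)"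
proof -
  have "((\<lambda>t. inverse t ^ m / exp (inverse t :: real)) \<longlongrightarrow> 0) (at_right 0)"
    by (rule filterlim_compose[OF tendsto_power_div_exp_0 filterlim_inverse_at_top_right])
  moreover have "eventually (\<lambda>t. inverse t ^ m / exp (inverse t :: real) = flat m t) (at_right 0)"
    by (auto simp: eventually_at_right_less flat_def exp_minus field_simps
        intro!: eventually_mono[OF eventually_at_right_less])
  ultimately show ?thesis
    using Lim_transform_eventually by blast
qed

lemma flat_has_derivative:
  "(flat m has_real_derivative flat (m + 2) t - real m * flat (m + 1) t) (at t)"
proof -
  consider "t < 0" | "t = 0" | "t > 0" by linarith
  then show ?thesis
  proof cases
    case 1
    have "((\<lambda>_. 0::real) has_real_derivative 0) (at t)" by simp
    then have "(flat m has_real_derivative 0) (at t)"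
      by (rule has_field_derivative_transform_within_open[where S = "{..<0}"])
         (use 1 in \<open>auto simp: flat_def\<close>)
    then show ?thesis using 1 by (simp add: flat_def)
  next
    case 3
    have e: "((\<lambda>t. inverse t ^ m * exp (- inverse t)) has_real_derivative
      (inverse t ^ m) * (exp (- inverse t) * (inverse t * inverse t))
       + (real m * (inverse t ^ (m - 1) * (- (inverse t * inverse t)))) * exp (- inverse t)) (at t)"
      using 3 by (auto intro!: derivative_eq_intros)
    \<comment> \<open>For \<open>m = 0\<close> the exponent \<open>m - 1\<close> truncates to 0,
      which is harmless because the factor \<open>real m\<close> vanishes.\<close>
    have "real m * (inverse t ^ (m - 1) * (inverse t * inverse t)) = real m * inverse t ^ (m + 1)"
      by (cases m) auto
    then have "(inverse t ^ m) * (exp (- inverse t) * (inverse t * inverse t))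
       + (real m * (inverse t ^ (m - 1) * (- (inverse t * inverse t)))) * exp (- inverse t)
       = flat (m + 2) t - real m * flat (m + 1) t"
      using 3 by (simp add: flat_def power_add power2_eq_square algebra_simps) (metis)
    with e have "((\<lambda>t. inverse t ^ m * exp (- inverse t)) has_real_derivative
      flat (m + 2) t - real m * flat (m + 1) t) (at t)" by simp
    then show ?thesis
      by (rule has_field_derivative_transform_within_open[where S = "{0<..}"])
         (use 3 in \<open>auto simp: flat_def\<close>)
  next
    case 2
    \<comment> \<open>To the right of 0 the difference quotient of \<open>flat m\<close> is
      \<open>flat (m + 1)\<close>, which tends to 0; to the left it is identically 0.\<close>
    have "((\<lambda>y. (flat m y - flat m 0) / (y - 0)) \<longlongrightarrow> 0) (at 0)"
    proof (rule filterlim_split_at)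
      have "eventually (\<lambda>y. 0 = (flat m y - flat m 0) / (y - 0)) (at_left 0)"
        by (rule eventually_mono[OF eventually_at_left_real[of "-1" 0]]) (auto simp: flat_def)
      then show "((\<lambda>y. (flat m y - flat m 0) / (y - 0)) \<longlongrightarrow> 0) (at_left 0)"
        by (rule Lim_transform_eventually[OF tendsto_const])
      have "eventually (\<lambda>y. flat (m + 1) y = (flat m y - flat m 0) / (y - 0)) (at_right 0)"
        by (rule eventually_mono[OF eventually_at_right_less]) (auto simp: flat_def field_simps)
      then show "((\<lambda>y. (flat m y - flat m 0) / (y - 0)) \<longlongrightarrow> 0) (at_right 0)"
        by (rule Lim_transform_eventually[OF flat_tendsto_0])
    qed
    then have "(flat m has_real_derivative 0) (at 0)"
      by (simp add: has_field_derivative_iff)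
    then show ?thesis using 2 by (simp add: flat_def)
  qed
qed

lemma Ck1_flat: "Ck1 k (flat m)"
proof (induction k arbitrary: m)
  case 0
  show ?case
    using flat_has_derivative by (auto intro!: DERIV_isCont simp: continuous_on_eq_continuous_at)
next
  case (Suc k)
  have "Ck1 k (\<lambda>t. flat (m + 2) t + (- real m) * flat (m + 1) t)"
    by (intro Ck1_add Ck1_mult Suc Ck1_const)
  then show ?case
    using flat_has_derivative[of m] by (auto intro!: exI[of _ "\<lambda>t. flat (m + 2) t - real m * flat (m + 1) t"])
qed

text \<open>The standard smooth transition from 0 to 1 over the unit interval, built from exp(-1/t).
  The denominator never vanishes because t or 1 - t is positive.\<close>

definition smooth_step :: "real \<Rightarrow> real" where
  "smooth_step t = flat 0 t * inverse (flat 0 t + flat 0 (1 - t))"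

lemma flat_sum_pos: "flat 0 t + flat 0 (1 - t) > 0"
  by (auto simp: flat_def add_pos_pos)

lemma Ck1_smooth_step: "Ck1 k smooth_step"
proof -
  have "Ck1 k (\<lambda>t. flat 0 (1 + (-1) * t))"
    by (intro Ck1_compose[OF Ck1_flat] Ck1_add Ck1_mult Ck1_ident Ck1_const)
  then have "Ck1 k (\<lambda>t. flat 0 (1 - t))" by simp
  then have "Ck1 k (\<lambda>t. flat 0 t * inverse (flat 0 t + flat 0 (1 - t)))"
    using flat_sum_pos by (intro Ck1_mult Ck1_inverse Ck1_add Ck1_flat) (metis less_irrefl)
  then show ?thesis
    unfolding smooth_step_def[abs_def] .
qed

lemma smooth_step_range: "0 \<le> smooth_step t" "smooth_step t \<le> 1"
proof -
  have "0 \<le> flat 0 t" "0 \<le> flat 0 (1 - t)" by (auto simp: flat_def)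
  then show "0 \<le> smooth_step t" "smooth_step t \<le> 1"
    using flat_sum_pos[of t] by (auto simp: smooth_step_def field_simps)
qed

lemma smooth_step_eq_0: "t \<le> 0 \<Longrightarrow> smooth_step t = 0"
  by (simp add: smooth_step_def flat_def)

lemma smooth_step_eq_1: "t \<ge> 1 \<Longrightarrow> smooth_step t = 1"
  by (simp add: smooth_step_def flat_def)

section \<open>Smooth functions and test functions in several variables\<close>

definition smooth :: "(real^'n \<Rightarrow> real) \<Rightarrow> bool" where
  "smooth u \<longleftrightarrow> (\<forall>k. Ck k u)"

lemma smooth_const [simp]: "smooth (\<lambda>_. c)"
  by (simp add: smooth_def)

lemma smooth_add: "smooth u \<Longrightarrow> smooth v \<Longrightarrow> smooth (\<lambda>x. u x + v x)"
  by (simp add: smooth_def Ck_add)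

lemma smooth_mult: "smooth u \<Longrightarrow> smooth v \<Longrightarrow> smooth (\<lambda>x. u x * v x)"
  by (simp add: smooth_def Ck_mult)

lemma smooth_diff: "smooth u \<Longrightarrow> smooth v \<Longrightarrow> smooth (\<lambda>x. u x - v x)"
  using smooth_add[of u "\<lambda>x. (-1) * v x"] smooth_mult[of "\<lambda>_. -1" v] by simp

lemma smooth_sum: "finite I \<Longrightarrow> (\<And>i. i \<in> I \<Longrightarrow> smooth (u i)) \<Longrightarrow> smooth (\<lambda>x. \<Sum>i\<in>I. u i x)"
  by (simp add: smooth_def Ck_sum)

lemma smooth_component: "smooth (\<lambda>x. x $ i)"
  by (simp add: smooth_def Ck_component)

lemma smooth_compose:
  assumes "smooth u" "\<And>j. smooth (\<lambda>x. T x $ j)"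
  shows "smooth (\<lambda>x. u (T x))"
  using assms Ck_compose unfolding smooth_def by blast

lemma smooth_compose_real: "(\<And>k. Ck1 k f) \<Longrightarrow> smooth u \<Longrightarrow> smooth (\<lambda>x. f (u x))"
  by (simp add: smooth_def Ck_compose_real)

lemma smooth_affine: "smooth u \<Longrightarrow> smooth (\<lambda>x. u (c + r *\<^sub>R x))"
  by (rule smooth_compose)
     (simp_all add: smooth_add smooth_mult smooth_component)

lemma smooth_differentiable: "smooth u \<Longrightarrow> u differentiable (at x)"
  by (metis Ck_Suc_differentiable smooth_def)

lemma smooth_has_derivative: "smooth u \<Longrightarrow> (u has_derivative (\<lambda>h. grad u x \<bullet> h)) (at x)"
  by (simp add: frechet_derivative_grad smooth_differentiable)

lemma smooth_continuous: "smooth u \<Longrightarrow> continuous_on A u"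
  unfolding smooth_def using Ck.simps(1) continuous_on_subset by blast

lemma smooth_continuous_grad: "smooth u \<Longrightarrow> continuous_on A (grad u)"
proof -
  assume "smooth u"
  then have "Ck (Suc 0) u" by (simp only: smooth_def)
  then have "continuous_on UNIV (\<lambda>x. \<chi> i. grad u x $ i)"
    by (intro continuous_on_vec_lambda) simp
  then show ?thesis
    using continuous_on_subset by auto
qed

lemma grad_affine:
  fixes u :: "real^'n \<Rightarrow> real"
  assumes "smooth u"
  shows "grad (\<lambda>x. u (c + r *\<^sub>R x)) x = r *\<^sub>R grad u (c + r *\<^sub>R x)"
proof (rule grad_eqI)
  have "((\<lambda>x. c + r *\<^sub>R x) has_derivative (\<lambda>h. r *\<^sub>R h)) (at x)"
    by (auto intro!: derivative_eq_intros)
  from has_derivative_compose[OF this smooth_has_derivative[OF assms]]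
  show "((\<lambda>x. u (c + r *\<^sub>R x)) has_derivative (\<lambda>h. (r *\<^sub>R grad u (c + r *\<^sub>R x)) \<bullet> h)) (at x)"
    by simp
qed

lemma test_funI:
  assumes "smooth u" "compact K" "K \<subseteq> D" "\<And>x. x \<notin> K \<Longrightarrow> u x = 0"
  shows "u \<in> test_fun D"
proof -
  have "closure {x. u x \<noteq> 0} \<subseteq> K"
    using assms by (intro closure_minimal) (auto intro: compact_imp_closed)
  moreover from this have "compact (closure {x. u x \<noteq> 0})"
    using assms(2) by (meson bounded_subset closed_closure compact_eq_bounded_closed)
  ultimately show ?thesis
    using assms unfolding test_fun_def smooth_def by blast
qed

lemma test_fun_smooth: "u \<in> test_fun D \<Longrightarrow> smooth u"
  unfolding test_fun_def smooth_def by blast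

text \<open>The complement of the support is open, so the gradient vanishes there together with the
  function.\<close>

lemma test_funE:
  assumes "u \<in> test_fun D"
  obtains K where "compact K" "K \<subseteq> D" "\<And>x. x \<notin> K \<Longrightarrow> u x = 0" "\<And>x. x \<notin> K \<Longrightarrow> grad u x = 0"
proof -
  define K where "K = closure {x. u x \<noteq> 0}"
  have K: "compact K" "K \<subseteq> D" "closed K"
    using assms unfolding test_fun_def K_def by (blast, blast, simp)
  have z: "u x = 0" if "x \<notin> K" for x
    using that closure_subset[of "{x. u x \<noteq> 0}"] unfolding K_def by blast
  have "grad u x = 0" if "x \<notin> K" for x
  proof -
    have "grad u x = grad (\<lambda>_. 0) x"
      by (rule grad_cong_open[of "- K"]) (use that K z in auto)
    then show ?thesis by simp
  qed
  with K z that show ?thesis by metis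
qed

lemma test_fun_mono: "u \<in> test_fun D \<Longrightarrow> D \<subseteq> D' \<Longrightarrow> u \<in> test_fun D'"
  unfolding test_fun_def by blast

lemma test_fun_grad_bounded:
  assumes "u \<in> test_fun D"
  obtains M where "0 < M" "\<And>x. norm (grad u x) \<le> M"
proof -
  obtain K where K: "compact K" "\<And>x. x \<notin> K \<Longrightarrow> grad u x = 0"
    using assms by (elim test_funE) blast
  have "compact (grad u ` K)"
    using K assms by (intro compact_continuous_image smooth_continuous_grad test_fun_smooth)
  then obtain M where "0 < M" "\<And>y. y \<in> grad u ` K \<Longrightarrow> norm y \<le> M"
    by (meson bounded_pos compact_imp_bounded)
  with K(2) have "norm (grad u x) \<le> M" for x
    by (cases "x \<in> K") auto
  with \<open>0 < M\<close> that show ?thesis by blast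
qed

section \<open>Cutoff functions and smooth truncation\<close>

text \<open>The step is applied to an affine function of |x|^2, a polynomial, because the norm is
  not smooth at the origin.\<close>

lemma ex_cutoff:
  assumes "0 < a" "a < b"
  shows "\<exists>\<theta>::real^'n \<Rightarrow> real. \<theta> \<in> test_fun (ball 0 b) \<and> (\<forall>x. 0 \<le> \<theta> x \<and> \<theta> x \<le> 1) \<and> (\<forall>x\<in>cball 0 a. \<theta> x = 1)"
proof -
  \<comment> \<open>The function already vanishes outside \<open>cball 0 m\<close>, a compact subset
    of the open ball of radius \<open>b\<close>.\<close>
  define m where "m = (a + b) / 2"
  have m: "a < m" "m < b" using assms by (auto simp: m_def)
  then have am: "a^2 < m^2" using assms by (simp add: power_strict_mono)
  define q where "q = (\<lambda>x::real^'n. (m^2 - (\<Sum>i\<in>UNIV. x $ i * x $ i)) * inverse (m^2 - a^2))"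
  have q: "q x = (m^2 - (norm x)^2) / (m^2 - a^2)" for x
    by (simp add: q_def power2_norm_eq_inner inner_vec_def divide_inverse)
  let ?\<theta> = "\<lambda>x. smooth_step (q x)"
  have "smooth q"
    unfolding q_def
    by (rule smooth_mult[OF smooth_diff[OF smooth_const smooth_sum[OF finite
          smooth_mult[OF smooth_component smooth_component]]] smooth_const])
  then have "smooth ?\<theta>"
    by (rule smooth_compose_real[OF Ck1_smooth_step])
  moreover have "?\<theta> x = 0" if "x \<notin> cball 0 m" for x
  proof -
    have "m^2 \<le> (norm x)^2"
      using that m assms by (intro power_mono) auto
    then show ?thesis
      using am by (intro smooth_step_eq_0) (simp add: q field_simps)
  qed
  ultimately have "?\<theta> \<in> test_fun (ball 0 b)"
    using m by (intro test_funI[where K = "cball 0 m"]) auto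
  moreover have "?\<theta> x = 1" if "x \<in> cball 0 a" for x
  proof -
    have "(norm x)^2 \<le> a^2"
      using that assms by (intro power_mono) auto
    then show ?thesis
      using am by (intro smooth_step_eq_1) (simp add: q field_simps)
  qed
  ultimately show ?thesis
    using smooth_step_range by blast
qed

text \<open>A smooth substitute for truncation of t to [0, 1], obtained by integrating a plateau and
  normalizing. The slope may exceed 1 by \<open>e\<close>, since a smooth function cannot rise from
  0 to 1 over the unit interval with slope at most 1 and flat ends. The value 1 is attained already
  at \<open>1 - d\<close>, so that a competitor which is at least 1 on a set is truncated to 1 in a
  neighbourhood of it.\<close>

lemma ex_truncation:
  fixes e :: real
  assumes "0 < e"
  shows "\<exists>\<psi> \<psi>' d. 0 < d \<and> (\<forall>k. Ck1 k \<psi>) \<and> (\<forall>t\<le>0. \<psi> t = 0) \<and> (\<forall>t\<ge>1-d. \<psi> t = 1) \<and>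
    (\<forall>t. 0 \<le> \<psi> t \<and> \<psi> t \<le> 1) \<and> (\<forall>t. (\<psi> has_real_derivative \<psi>' t) (at t) \<and> \<bar>\<psi>' t\<bar> \<le> 1 + e)"
proof -
  \<comment> \<open>Chosen so that (1 + e) (1 - 4 d) = 1, where 1 - 4 d is the length of the
    plateau.\<close>
  define d where "d = e / (4 * (1 + e))"
  have d: "0 < d" "4 * d < 1" using assms by (auto simp: d_def field_simps)
  \<comment> \<open>The plateau: 0 outside (d, 1 - d) and 1 on [2 d, 1 - 2 d]. The arguments of the
    two steps are t/d - 1 and (1 - t)/d - 1, spelled out as sums and products to match the closure
    rules of \<open>Ck1\<close>.\<close>
  define \<sigma> where "\<sigma> = (\<lambda>t. smooth_step (t * inverse d + (-1)) * smooth_step ((1 - d) * inverse d + (- inverse d) * t))"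
  have C: "Ck1 k \<sigma>" for k
    unfolding \<sigma>_def
    by (rule Ck1_mult[OF
          Ck1_compose[OF Ck1_smooth_step Ck1_add[OF Ck1_mult[OF Ck1_ident Ck1_const] Ck1_const]]
          Ck1_compose[OF Ck1_smooth_step Ck1_add[OF Ck1_const Ck1_mult[OF Ck1_const Ck1_ident]]]])
  have r: "0 \<le> \<sigma> t" "\<sigma> t \<le> 1" for t
    by (auto simp: \<sigma>_def smooth_step_range mult_le_one)
  have z: "\<sigma> t = 0" if "t \<le> d \<or> t \<ge> 1 - d" for t
    using that
  proof
    assume "t \<le> d"
    then have "smooth_step (t * inverse d + (-1)) = 0"
      using d by (intro smooth_step_eq_0) (simp add: field_simps)
    then show ?thesis by (simp add: \<sigma>_def)
  next
    assume "t \<ge> 1 - d"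
    then have "smooth_step ((1 - d) * inverse d + (- inverse d) * t) = 0"
      using d \<open>t \<ge> 1 - d\<close> mult_left_mono[of "1 - d" t "inverse d"]
      by (intro smooth_step_eq_0) (simp add: mult.commute)
    then show ?thesis by (simp add: \<sigma>_def)
  qed
  have o: "\<sigma> t = 1" if "2 * d \<le> t" "t \<le> 1 - 2 * d" for t
  proof -
    have "2 \<le> t / d" "2 \<le> (1 - t) / d"
      using d that by (simp_all add: pos_le_divide_eq)
    moreover have "t * inverse d + (-1) = t / d - 1"
        "(1 - d) * inverse d + (- inverse d) * t = (1 - t) / d - 1"
      using d by (simp_all add: field_simps)
    ultimately have "smooth_step (t * inverse d + (-1)) = 1"
        "smooth_step ((1 - d) * inverse d + (- inverse d) * t) = 1"
      by (auto intro!: smooth_step_eq_1)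
    then show ?thesis by (simp add: \<sigma>_def)
  qed
  have "continuous_on UNIV \<sigma>"
    using C[of 0] by simp
  \<comment> \<open>An antiderivative on the whole line, so that no gluing at 0 and 1 is
    needed.\<close>
  then have "\<exists>F. \<forall>x::real. -\<infinity> < ereal x \<longrightarrow> ereal x < \<infinity> \<longrightarrow> (F has_vector_derivative \<sigma> x) (at x)"
    by (intro einterval_antiderivative) (auto simp: continuous_on_eq_continuous_at)
  then obtain F where F: "(F has_real_derivative \<sigma> t) (at t)" for t
    by (auto simp: has_real_derivative_iff_has_vector_derivative)
  have mono: "F s \<le> F t" if "s \<le> t" for s t
    using that F r by (meson DERIV_nonneg_imp_nondecreasing)
  have lo: "F t = F 0" if "t \<le> 0" for t
  proof -
    have "\<exists>c. \<forall>x\<in>{..0}. F x = c"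
      using has_field_derivative_at_within[OF F] z d
      by (intro has_field_derivative_zero_constant) (auto, metis less_eq_real_def order_trans)
    with that show ?thesis by auto
  qed
  have hi: "F t = F 1" if "t \<ge> 1 - d" for t
  proof -
    have "\<exists>c. \<forall>x\<in>{1-d..}. F x = c"
      using has_field_derivative_at_within[OF F] z
      by (intro has_field_derivative_zero_constant) (auto, metis)
    with that d show ?thesis by auto
  qed
  define Z where "Z = F 1 - F 0"
  \<comment> \<open>On the plateau the slope is 1, so the mean value theorem gives the exact
    increase of \<open>F\<close> there and hence a lower bound for the normalizing constant
    \<open>Z\<close>.\<close>
  have "\<exists>x>2*d. x < 1 - 2*d \<and> F (1 - 2*d) - F (2*d) = (1 - 2*d - 2*d) * \<sigma> x"
    using d F by (intro MVT2) auto
  then have "F (1 - 2*d) - F (2*d) = 1 - 4 * d"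
    using o by auto
  then have Z: "1 - 4 * d \<le> Z" "0 < Z"
    using mono[of 0 "2*d"] mono[of "1-2*d" 1] d by (auto simp: Z_def)
  define \<psi> where "\<psi> = (\<lambda>t. (F t - F 0) * inverse Z)"
  have D: "(\<psi> has_real_derivative \<sigma> t * inverse Z) (at t)" for t
    unfolding \<psi>_def by (intro DERIV_cmult_right) (use DERIV_diff[OF F DERIV_const] in simp)
  have "Ck1 k \<psi>" for k
  proof (rule Ck1_SucD)
    have "Ck1 k (\<lambda>t. \<sigma> t * inverse Z)"
      by (rule Ck1_mult[OF C Ck1_const])
    with D show "Ck1 (Suc k) \<psi>"
      unfolding Ck1.simps by (intro exI[of _ "\<lambda>t. \<sigma> t * inverse Z"] conjI allI)
  qed
  moreover have "\<psi> t = 0" if "t \<le> 0" for t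
    using lo[OF that] by (simp add: \<psi>_def)
  moreover have "\<psi> t = 1" if "t \<ge> 1 - d" for t
    using hi[OF that] Z by (simp add: \<psi>_def Z_def)
  moreover have "0 \<le> \<psi> t" for t
    using mono[of 0 t] lo[of t] Z by (cases "t \<le> 0") (auto simp: \<psi>_def)
  moreover have "\<psi> t \<le> 1" for t
    using mono[of t 1] hi[of t] Z d by (cases "t \<le> 1") (auto simp: \<psi>_def Z_def field_simps)
  moreover have "\<bar>\<sigma> t * inverse Z\<bar> \<le> 1 + e" for t
  proof -
    have "1 \<le> (1 + e) * (1 - 4 * d)"
      using assms by (simp add: d_def field_simps)
    also have "\<dots> \<le> (1 + e) * Z"
      using Z assms by (intro mult_left_mono) auto
    finally have "inverse Z \<le> 1 + e"
      using Z by (simp add: field_simps)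
    moreover have "\<bar>\<sigma> t * inverse Z\<bar> \<le> inverse Z"
      using r[of t] Z by (simp add: abs_mult mult_left_le_one_le)
    ultimately show ?thesis by linarith
  qed
  ultimately show ?thesis
    using D d(1) by (intro exI[of _ \<psi>] exI[of _ "\<lambda>t. \<sigma> t * inverse Z"] exI[of _ d]) blast
qed

section \<open>The energy and its control of translations\<close>

definition energy :: "real \<Rightarrow> (real^'n \<Rightarrow> real) \<Rightarrow> ennreal" where
  "energy p u = (\<integral>\<^sup>+x. ennreal (norm (grad u x) powr p) \<partial>lborel)"

lemma smooth_measurable: "smooth u \<Longrightarrow> u \<in> borel_measurable borel"
  by (rule borel_measurable_continuous_onI) (rule smooth_continuous)

lemma smooth_grad_measurable: "smooth u \<Longrightarrow> grad u \<in> borel_measurable borel"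
  by (rule borel_measurable_continuous_onI) (rule smooth_continuous_grad)

lemma nn_integral_affine:
  fixes c :: "'a::euclidean_space"
  assumes [measurable]: "f \<in> borel_measurable borel" and "0 < r"
  shows "(\<integral>\<^sup>+x. f (c + r *\<^sub>R x) \<partial>lborel) = ennreal (inverse r ^ DIM('a)) * (\<integral>\<^sup>+x. f x \<partial>lborel)"
proof -
  have "(\<integral>\<^sup>+x. f x \<partial>lborel) =
      (\<integral>\<^sup>+x. f x \<partial>density (distr lborel borel (\<lambda>x. c + r *\<^sub>R x)) (\<lambda>_. ennreal (\<bar>r\<bar> ^ DIM('a))))"
    using lborel_affine[of r c] assms(2) by simp
  also have "\<dots> = ennreal (r ^ DIM('a)) * (\<integral>\<^sup>+x. f (c + r *\<^sub>R x) \<partial>lborel)"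
    using assms(2) by (simp add: nn_integral_density nn_integral_distr nn_integral_cmult)
  finally have "ennreal (inverse r ^ DIM('a)) * (\<integral>\<^sup>+x. f x \<partial>lborel) =
      ennreal (inverse r ^ DIM('a) * r ^ DIM('a)) * (\<integral>\<^sup>+x. f (c + r *\<^sub>R x) \<partial>lborel)"
    using assms(2) by (simp add: ennreal_mult mult.assoc)
  also have "inverse r ^ DIM('a) * r ^ DIM('a) = 1"
    using assms(2) by (simp flip: power_mult_distrib)
  finally show ?thesis by simp
qed

lemma nn_integral_shift:
  fixes c :: "'a::euclidean_space"
  assumes "f \<in> borel_measurable borel"
  shows "(\<integral>\<^sup>+x. f (c + x) \<partial>lborel) = (\<integral>\<^sup>+x. f x \<partial>lborel)"
  using nn_integral_affine[OF assms, of 1 c] by simp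

text \<open>For t > a one has t = t^(1-p) t^p \<le> a^(1-p) t^p. The threshold \<open>a\<close>
  remains free: later it is chosen so that the contribution of the first term can be
  absorbed.\<close>

lemma young_powr:
  fixes t a p :: real
  assumes "0 \<le> t" "0 < a" "1 \<le> p"
  shows "t \<le> a + a powr (1 - p) * t powr p"
proof (cases "t \<le> a")
  case True
  then show ?thesis by (simp add: add_increasing2)
next
  case False
  have "t = t powr (1 - p) * t powr p"
    using False assms by (simp flip: powr_add)
  also have "\<dots> \<le> a powr (1 - p) * t powr p"
    using False assms by (intro mult_right_mono powr_mono2') auto
  finally show ?thesis using assms by linarith
qed

lemma nn_integral_FTC_abs_le:
  fixes \<phi> :: "real \<Rightarrow> real"
  assumes "a \<le> b" "\<And>t. (\<phi> has_real_derivative \<phi>' t) (at t)" "continuous_on UNIV \<phi>'"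
  shows "ennreal \<bar>\<phi> b - \<phi> a\<bar> \<le> (\<integral>\<^sup>+t\<in>{a..b}. ennreal \<bar>\<phi>' t\<bar> \<partial>lborel)"
proof -
  have 1: "(\<phi>' has_integral (\<phi> b - \<phi> a)) {a..b}"
    using assms(1,2)
    by (intro fundamental_theorem_of_calculus)
       (auto simp flip: has_real_derivative_iff_has_vector_derivative intro: has_field_derivative_at_within)
  have 2: "(\<lambda>t. \<bar>\<phi>' t\<bar>) integrable_on {a..b}"
    by (intro integrable_continuous_real continuous_intros continuous_on_subset[OF assms(3)]) auto
  have "ennreal \<bar>\<phi> b - \<phi> a\<bar> \<le> ennreal (integral {a..b} (\<lambda>t. \<bar>\<phi>' t\<bar>))"
    using integral_norm_bound_integral[of \<phi>' "{a..b}" "\<lambda>t. \<bar>\<phi>' t\<bar>"] 1 2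
    by (intro ennreal_leI) (auto simp: integral_unique has_integral_integrable)
  also have "\<dots> = (\<integral>\<^sup>+t\<in>{a..b}. ennreal \<bar>\<phi>' t\<bar> \<partial>lborel)"
    using nn_integral_has_integral_lebesgue'[OF _ integrable_integral[OF 2]] by simp
  finally show ?thesis .
qed

lemma line_has_derivative:
  fixes u :: "real^'n \<Rightarrow> real"
  assumes "smooth u"
  shows "((\<lambda>t. u (x + t *\<^sub>R h)) has_real_derivative (grad u (x + t *\<^sub>R h) \<bullet> h)) (at t)"
proof -
  have "((\<lambda>t. x + t *\<^sub>R h) has_derivative (\<lambda>s. s *\<^sub>R h)) (at t)"
    by (auto intro!: derivative_eq_intros)
  from has_derivative_compose[OF this smooth_has_derivative[OF assms]]
  show ?thesis
    unfolding has_field_derivative_def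
    by (rule has_derivative_eq_rhs) (auto simp: mult.commute)
qed

text \<open>The absorption step. Splitting on whether \<open>I\<close> is finite confines the
  subtraction of T/2 to real numbers.\<close>

lemma ennreal_le_half_add:
  assumes "0 < T" "ennreal T \<le> ennreal (T / 2) + ennreal c * I" "0 < c"
  shows "ennreal (T / (2 * c)) \<le> I"
proof (cases I)
  case (real r)
  have "ennreal (T / 2) + ennreal c * I = ennreal (T / 2 + c * r)"
    using real assms by (simp add: ennreal_mult ennreal_plus)
  then have "ennreal T \<le> ennreal (T / 2 + c * r)"
    using assms(2) by metis
  then have "T \<le> T / 2 + c * r"
    using assms real by (subst (asm) ennreal_le_iff) auto
  then have "T / (2 * c) \<le> r"
    using assms by (simp add: field_simps)
  then show ?thesis using real by (simp add: ennreal_leI)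
qed simp

text \<open>Stands in for Hoelder's inequality along the segment from x to x + h. Absorption costs
  the factor 2^p.\<close>

lemma powr_difference_le_line_integral:
  fixes u :: "real^'n \<Rightarrow> real"
  assumes "smooth u" "1 \<le> p"
  shows "ennreal (\<bar>u (x + h) - u x\<bar> powr p) \<le>
    ennreal ((2 * norm h) powr p) * (\<integral>\<^sup>+t\<in>{0..1}. ennreal (norm (grad u (x + t *\<^sub>R h)) powr p) \<partial>lborel)"
    (is "_ \<le> _ * ?I")
proof (cases "u (x + h) = u x")
  case False
  define T where "T = \<bar>u (x + h) - u x\<bar>"
  \<comment> \<open>With this threshold the constant term of Young's inequality integrates over the
    segment to exactly T/2.\<close>
  define a where "a = T / (2 * norm h)"
  have h: "h \<noteq> 0" using False by auto
  then have T: "0 < T" "0 < a" "T / 2 = a * norm h" using False by (auto simp: T_def a_def)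
  have [measurable]: "grad u \<in> borel_measurable borel"
    by (rule smooth_grad_measurable[OF assms(1)])
  have line: "continuous_on UNIV (\<lambda>t::real. grad u (x + t *\<^sub>R h))"
    by (rule continuous_on_compose2[OF smooth_continuous_grad[OF assms(1), of UNIV]]) (auto intro!: continuous_intros)
  then have [measurable]: "(\<lambda>t::real. grad u (x + t *\<^sub>R h)) \<in> borel_measurable borel"
    by (rule borel_measurable_continuous_onI)
  have *: "\<bar>grad u (x + t *\<^sub>R h) \<bullet> h\<bar> \<le>
      a * norm h + (norm h * a powr (1 - p)) * norm (grad u (x + t *\<^sub>R h)) powr p" for t
  proof -
    have "\<bar>grad u (x + t *\<^sub>R h) \<bullet> h\<bar> \<le> norm (grad u (x + t *\<^sub>R h)) * norm h"
      by (rule Cauchy_Schwarz_ineq2)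
    also have "\<dots> \<le> (a + a powr (1 - p) * norm (grad u (x + t *\<^sub>R h)) powr p) * norm h"
      using young_powr[of "norm (grad u (x + t *\<^sub>R h))" a p] T assms by (intro mult_right_mono) auto
    finally show ?thesis by (simp add: algebra_simps)
  qed
  have "ennreal T \<le> (\<integral>\<^sup>+t\<in>{0..1}. ennreal \<bar>grad u (x + t *\<^sub>R h) \<bullet> h\<bar> \<partial>lborel)"
    using nn_integral_FTC_abs_le[of 0 1 "\<lambda>t. u (x + t *\<^sub>R h)", OF _ line_has_derivative[OF assms(1)]] line
    by (simp add: T_def continuous_on_inner)
  also have "\<dots> \<le> (\<integral>\<^sup>+t. ennreal (a * norm h) * indicator {0..1} t +
      ennreal (norm h * a powr (1 - p)) * (ennreal (norm (grad u (x + t *\<^sub>R h)) powr p) * indicator {0..1} t) \<partial>lborel)"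
  proof (rule nn_integral_mono)
    fix t :: real
    have "ennreal \<bar>grad u (x + t *\<^sub>R h) \<bullet> h\<bar> \<le> ennreal (a * norm h) +
      ennreal (norm h * a powr (1 - p)) * ennreal (norm (grad u (x + t *\<^sub>R h)) powr p)"
      using *[of t] T by (simp flip: ennreal_plus ennreal_mult' add: ennreal_leI)
    then show "ennreal \<bar>grad u (x + t *\<^sub>R h) \<bullet> h\<bar> * indicator {0..1} t \<le>
       ennreal (a * norm h) * indicator {0..1} t +
      ennreal (norm h * a powr (1 - p)) * (ennreal (norm (grad u (x + t *\<^sub>R h)) powr p) * indicator {0..1} t)"
      by (auto simp: indicator_def)
  qed
  also have "\<dots> = ennreal (T / 2) + ennreal (norm h * a powr (1 - p)) * ?I"
    using T by (simp add: nn_integral_add nn_integral_cmult)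
  finally have "ennreal (T / (2 * (norm h * a powr (1 - p)))) \<le> ?I"
    using T h by (intro ennreal_le_half_add) auto
  moreover have "T / (2 * (norm h * a powr (1 - p))) = a powr p"
    using h T by (simp add: powr_diff field_simps)
  ultimately have "ennreal ((2 * norm h) powr p) * ennreal (a powr p) \<le> ennreal ((2 * norm h) powr p) * ?I"
    by (intro mult_left_mono) auto
  moreover have "(2 * norm h) powr p * a powr p = T powr p"
    using h T by (simp add: a_def flip: powr_mult)
  ultimately show ?thesis
    by (simp add: T_def flip: ennreal_mult)
qed simp

text \<open>After the integrals are exchanged, translation invariance makes the inner one equal to
  the energy for every t.\<close>

lemma translation_estimate:
  fixes u :: "real^'n \<Rightarrow> real"
  assumes "smooth u" "1 \<le> p"
  shows "(\<integral>\<^sup>+x. ennreal (\<bar>u (x + h) - u x\<bar> powr p) \<partial>lborel) \<le> ennreal ((2 * norm h) powr p) * energy p u"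
proof -
  have [measurable]: "grad u \<in> borel_measurable borel"
    by (rule smooth_grad_measurable[OF assms(1)])
  have m: "(\<lambda>x. ennreal (norm (grad u x) powr p)) \<in> borel_measurable borel"
    by measurable
  let ?f = "\<lambda>x t. ennreal (norm (grad u (x + t *\<^sub>R h)) powr p) * indicator {0..1::real} t"
  have "(\<integral>\<^sup>+x. ennreal (\<bar>u (x + h) - u x\<bar> powr p) \<partial>lborel) \<le>
      (\<integral>\<^sup>+x. ennreal ((2 * norm h) powr p) * (\<integral>\<^sup>+t. ?f x t \<partial>lborel) \<partial>lborel)"
    by (intro nn_integral_mono powr_difference_le_line_integral assms)
  also have "\<dots> = ennreal ((2 * norm h) powr p) * (\<integral>\<^sup>+x. \<integral>\<^sup>+t. ?f x t \<partial>lborel \<partial>lborel)"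
    by (intro nn_integral_cmult) measurable
  also have "(\<integral>\<^sup>+x. \<integral>\<^sup>+t. ?f x t \<partial>lborel \<partial>lborel) = (\<integral>\<^sup>+t. \<integral>\<^sup>+x. ?f x t \<partial>lborel \<partial>lborel)"
    by (rule lborel_pair.Fubini'[symmetric]) measurable
  also have "\<dots> = (\<integral>\<^sup>+t. energy p u * indicator {0..1::real} t \<partial>lborel)"
  proof (rule nn_integral_cong)
    fix t :: real
    have "(\<integral>\<^sup>+x. ?f x t \<partial>lborel) = (\<integral>\<^sup>+x. ennreal (norm (grad u (x + t *\<^sub>R h)) powr p) \<partial>lborel) * indicator {0..1} t"
      by (rule nn_integral_multc) measurable
    also have "(\<integral>\<^sup>+x. ennreal (norm (grad u (x + t *\<^sub>R h)) powr p) \<partial>lborel) = energy p u"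
      using nn_integral_shift[OF m, of "t *\<^sub>R h"] by (simp add: energy_def add.commute)
    finally show "(\<integral>\<^sup>+x. ?f x t \<partial>lborel) = energy p u * indicator {0..1} t" .
  qed
  also have "\<dots> = energy p u"
    by (simp add: nn_integral_cmult)
  finally show ?thesis .
qed

section \<open>Change of variables for expanding maps\<close>

lemma emeasure_lborel_negligible: "negligible N \<Longrightarrow> N \<in> sets borel \<Longrightarrow> emeasure lborel N = 0"
  using null_sets_completion_iff[of N lborel] by (simp add: negligible_iff_null_sets null_setsD1)

text \<open>The preimage of a ball under an expanding map lies in a ball of proportional radius, so a Vitali
  covering of an open set by disjoint balls gives the sharp constant without a Jacobian.\<close>

lemma emeasure_vimage_open_expanding:
  fixes T :: "'a::euclidean_space \<Rightarrow> 'a"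
  assumes m: "0 < m" and T: "\<And>x y. m * dist x y \<le> dist (T x) (T y)" and "surj T"
    and cont: "continuous_on UNIV T" and U: "open U"
  shows "emeasure lborel (T -` U) \<le> ennreal (inverse m ^ DIM('a)) * emeasure lborel U"
proof -
  define c where "c = ennreal (inverse m ^ DIM('a))"
  have inj: "inj T"
  proof (rule injI)
    fix x y assume "T x = T y"
    then show "x = y" using T[of x y] m by (simp add: mult_le_0_iff)
  qed
  define S where "S = inv T"
  have ST: "T (S y) = y" "S (T x) = x" for x y
    using inj \<open>surj T\<close> by (auto simp: S_def surj_f_inv_f)
  have opn: "open (T -` V)" if "open V" for V
    using cont that by (simp add: open_vimage)
  have mb[measurable]: "T \<in> borel_measurable borel"
    using cont by (rule borel_measurable_continuous_onI)
  define K where "K = {(a, r). 0 < r \<and> ball a r \<subseteq> U}"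
  obtain C where C: "countable C" "C \<subseteq> K"
     "pairwise (\<lambda>i j. disjnt (ball (fst i) (snd i)) (ball (fst j) (snd j))) C"
     "negligible (U - (\<Union>i \<in> C. ball (fst i) (snd i)))"
  proof (rule Vitali_covering_theorem_balls[of U K fst snd])
    fix x and d :: real assume "x \<in> U" "0 < d"
    then obtain e where e: "0 < e" "ball x e \<subseteq> U"
      using U open_contains_ball by blast
    define e' where "e' = min e (d / 2)"
    have "0 < e'" "e' < d" "ball x e' \<subseteq> ball x e"
      using e \<open>0 < d\<close> by (auto simp: e'_def subset_ball)
    then show "\<exists>i. i \<in> K \<and> x \<in> ball (fst i) (snd i) \<and> snd i < d"
      using e by (intro exI[of _ "(x, e')"]) (auto simp: K_def)
  qed blast
  define B where "B = (\<lambda>i::'a \<times> real. ball (fst i) (snd i))"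
  define N where "N = U - (\<Union>i\<in>C. B i)"
  have disj: "disjoint_family_on B C"
    using C(3) by (auto simp: disjoint_family_on_def pairwise_def disjnt_def B_def)
  have disjT: "disjoint_family_on (\<lambda>i. T -` B i) C"
    using disj unfolding disjoint_family_on_def by (metis vimage_Int vimage_empty)
  have BU: "B i \<subseteq> U" "0 < snd i" if "i \<in> C" for i
  proof -
    have "i \<in> K" using that C(2) by blast
    then show "B i \<subseteq> U" "0 < snd i" by (cases i; simp add: K_def B_def)+
  qed
  have N[measurable]: "N \<in> sets borel"
    unfolding N_def B_def by (intro sets.Diff borel_open U open_UN ballI open_ball)
  \<comment> \<open>The Vitali covering misses a null set; its preimage is null because the inverse
    map is Lipschitz with constant 1/m.\<close>
  have "negligible (S ` N)"
  proof (rule negligible_locally_Lipschitz_image)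
    show "negligible N" using C(4) by (simp add: N_def B_def)
    fix x
    have "norm (S y - S x) \<le> inverse m * norm (y - x)" for y
      using T[of "S y" "S x"] m by (simp add: ST dist_norm field_simps)
    then show "\<exists>V B. open V \<and> x \<in> V \<and> (\<forall>y\<in>N \<inter> V. norm (S y - S x) \<le> B * norm (y - x))"
      by (intro exI[of _ UNIV] exI[of _ "inverse m"]) auto
  qed simp
  also have "S ` N = T -` N"
  proof (intro equalityI subsetI)
    fix x assume "x \<in> T -` N"
    then have "S (T x) \<in> S ` N" by blast
    then show "x \<in> S ` N" by (simp only: ST)
  qed (use ST(1) in auto)
  finally have 0: "emeasure lborel (T -` N) = 0"
    using measurable_sets_borel[OF mb N] by (intro emeasure_lborel_negligible)
  have ball: "emeasure lborel (T -` B i) \<le> c * emeasure lborel (B i)" if "i \<in> C" for i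
  proof -
    have "T -` B i \<subseteq> ball (S (fst i)) (inverse m * snd i)"
    proof
      fix x assume "x \<in> T -` B i"
      then show "x \<in> ball (S (fst i)) (inverse m * snd i)"
        using T[of "S (fst i)" x] m by (auto simp: ST B_def field_simps)
    qed
    then have "emeasure lborel (T -` B i) \<le> emeasure lborel (ball (S (fst i)) (inverse m * snd i))"
      by (intro emeasure_mono) auto
    also have "\<dots> = c * emeasure lborel (B i)"
      using BU(2)[OF that] m
      by (simp add: B_def c_def emeasure_ball power_mult_distrib ac_simps flip: ennreal_mult)
    finally show ?thesis .
  qed
  have "T -` U = T -` (\<Union>i\<in>C. B i) \<union> T -` N"
    using BU by (auto simp: N_def)
  then have "emeasure lborel (T -` U) \<le> emeasure lborel (T -` (\<Union>i\<in>C. B i)) + emeasure lborel (T -` N)"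
    using measurable_sets_borel[OF mb N] borel_open[OF opn, of "\<Union>i\<in>C. B i"]
    by (auto intro!: emeasure_subadditive simp: B_def open_UN)
  also have "\<dots> = emeasure lborel (\<Union>i\<in>C. T -` B i)"
    by (simp add: 0 vimage_UN)
  also have "\<dots> = (\<integral>\<^sup>+i. emeasure lborel (T -` B i) \<partial>count_space C)"
    using C(1) disjT opn by (intro emeasure_UN_countable) (auto simp: B_def)
  also have "\<dots> \<le> (\<integral>\<^sup>+i. c * emeasure lborel (B i) \<partial>count_space C)"
    using ball by (intro nn_integral_mono) auto
  also have "\<dots> = c * (\<integral>\<^sup>+i. emeasure lborel (B i) \<partial>count_space C)"
    by (intro nn_integral_cmult) auto
  also have "(\<integral>\<^sup>+i. emeasure lborel (B i) \<partial>count_space C) = emeasure lborel (\<Union>i\<in>C. B i)"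
    using C(1) disj by (intro emeasure_UN_countable[symmetric]) (auto simp: B_def)
  also have "\<dots> \<le> emeasure lborel U"
    using BU U by (intro emeasure_mono) auto
  finally show ?thesis
    by (simp add: c_def mult_left_mono)
qed

text \<open>Outer regularity carries the bound from open sets to Borel sets, and induction over
  nonnegative measurable functions carries it to integrals.\<close>

lemma nn_integral_expanding_le:
  fixes T :: "'a::euclidean_space \<Rightarrow> 'a"
  assumes m: "0 < m" and T: "\<And>x y. m * dist x y \<le> dist (T x) (T y)" and "surj T"
    and cont: "continuous_on UNIV T" and f: "f \<in> borel_measurable borel"
  shows "(\<integral>\<^sup>+x. f (T x) \<partial>lborel) \<le> ennreal (inverse m ^ DIM('a)) * (\<integral>\<^sup>+x. f x \<partial>lborel)"
proof -
  define c where "c = inverse m ^ DIM('a)"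
  have c: "0 < c" using m by (simp add: c_def)
  have mb[measurable]: "T \<in> borel_measurable borel"
    using cont by (rule borel_measurable_continuous_onI)
  have set: "emeasure lborel (T -` A) \<le> ennreal c * emeasure lborel A" if A: "A \<in> sets borel" for A
  proof (rule ennreal_le_epsilon)
    fix e :: real assume "0 < e"
    \<comment> \<open>The excess measure is multiplied by \<open>c\<close> below, so e/c is the
      tolerance that leaves \<open>e\<close>.\<close>
    then have "0 < e / c" using c by simp
    then obtain U where U: "open U" "A \<subseteq> U" "emeasure lborel (U - A) < ennreal (e / c)"
      using outer_regular_lborel[OF A] by blast
    have "emeasure lborel (T -` A) \<le> emeasure lborel (T -` U)"
      using U cont by (intro emeasure_mono) (auto intro!: open_vimage borel_open)
    also have "\<dots> \<le> ennreal c * emeasure lborel U"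
      unfolding c_def by (rule emeasure_vimage_open_expanding[OF m T \<open>surj T\<close> cont U(1)])
    also have "emeasure lborel U = emeasure lborel A + emeasure lborel (U - A)"
      using U A by (subst plus_emeasure) (auto simp: Un_absorb1)
    also have "ennreal c * \<dots> \<le> ennreal c * (emeasure lborel A + ennreal (e / c))"
      using U(3) by (intro mult_left_mono add_left_mono) auto
    also have "\<dots> = ennreal c * emeasure lborel A + ennreal e"
      using c \<open>0 < e\<close> by (simp add: distrib_left flip: ennreal_mult)
    finally show "emeasure lborel (T -` A) \<le> ennreal c * emeasure lborel A + ennreal e" .
  qed
  have "(\<integral>\<^sup>+x. f (T x) \<partial>lborel) \<le> ennreal c * (\<integral>\<^sup>+x. f x \<partial>lborel)"
    using f
  proof (induction f rule: borel_measurable_induct)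
    case (cong f g)
    then show ?case by (metis (no_types, lifting) UNIV_I nn_integral_cong space_borel)
  next
    case (set A)
    have "(\<integral>\<^sup>+x. indicator A (T x) \<partial>lborel) = (\<integral>\<^sup>+x. indicator (T -` A) x \<partial>lborel)"
      by (simp add: indicator_def)
    also have "\<dots> = emeasure lborel (T -` A)"
      using measurable_sets_borel[OF mb set] by simp
    finally show ?case
      using \<open>\<And>A. A \<in> sets borel \<Longrightarrow> emeasure lborel (T -` A) \<le> _\<close>[OF set] set by simp
  next
    case (mult u a)
    have [measurable]: "u \<in> borel_measurable borel" by fact
    have "(\<integral>\<^sup>+x. a * u (T x) \<partial>lborel) = a * (\<integral>\<^sup>+x. u (T x) \<partial>lborel)"
      by (intro nn_integral_cmult) measurable
    also have "\<dots> \<le> a * (ennreal c * (\<integral>\<^sup>+x. u x \<partial>lborel))"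
      using mult by (intro mult_left_mono) auto
    also have "\<dots> = ennreal c * (\<integral>\<^sup>+x. a * u x \<partial>lborel)"
      by (subst nn_integral_cmult) (auto simp: ac_simps)
    finally show ?case .
  next
    case (add u v)
    have [measurable]: "u \<in> borel_measurable borel" "v \<in> borel_measurable borel" by fact+
    have "(\<integral>\<^sup>+x. v (T x) + u (T x) \<partial>lborel) = (\<integral>\<^sup>+x. v (T x) \<partial>lborel) + (\<integral>\<^sup>+x. u (T x) \<partial>lborel)"
      by (intro nn_integral_add) measurable
    also have "\<dots> \<le> ennreal c * (\<integral>\<^sup>+x. v x \<partial>lborel) + ennreal c * (\<integral>\<^sup>+x. u x \<partial>lborel)"
      using add by (intro add_mono) auto
    also have "\<dots> = ennreal c * (\<integral>\<^sup>+x. v x + u x \<partial>lborel)"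
      by (subst nn_integral_add) (auto simp: distrib_left)
    finally show ?case .
  next
    case (seq U)
    have [measurable]: "U i \<in> borel_measurable borel" for i by fact
    have inc: "incseq (\<lambda>i x. U i (T x))"
      using \<open>incseq U\<close> by (auto simp: incseq_def le_fun_def)
    have eq: "(SUP i. U i) (T x) = (SUP i. U i (T x))" for x by (simp add: image_comp)
    have "(\<integral>\<^sup>+x. (SUP i. U i) (T x) \<partial>lborel) = (SUP i. \<integral>\<^sup>+x. U i (T x) \<partial>lborel)"
      unfolding eq using inc by (intro nn_integral_monotone_convergence_SUP) measurable
    also have "\<dots> \<le> ennreal c * (\<integral>\<^sup>+x. (SUP i. U i) x \<partial>lborel)"
    proof (rule SUP_least)
      fix i
      have "(\<integral>\<^sup>+x. U i (T x) \<partial>lborel) \<le> ennreal c * (\<integral>\<^sup>+x. U i x \<partial>lborel)" by fact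
      also have "\<dots> \<le> ennreal c * (\<integral>\<^sup>+x. (SUP i. U i) x \<partial>lborel)"
        by (intro mult_left_mono nn_integral_mono) (auto simp: image_comp intro: SUP_upper)
      finally show "(\<integral>\<^sup>+x. U i (T x) \<partial>lborel) \<le> ennreal c * (\<integral>\<^sup>+x. (SUP i. U i) x \<partial>lborel)" .
    qed
    finally show ?case .
  qed
  then show ?thesis by (simp add: c_def)
qed

section \<open>Energy and capacity\<close>

lemma p_capacity_in_energy: "p_capacity_in D p F = (INF u \<in> {u \<in> test_fun D. \<forall>x\<in>F. u x \<ge> 1}. energy p u)"
  by (simp add: p_capacity_in_def energy_def)

lemma p_capacity_in_le: "u \<in> test_fun D \<Longrightarrow> (\<And>x. x \<in> F \<Longrightarrow> 1 \<le> u x) \<Longrightarrow> p_capacity_in D p F \<le> energy p u"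
  unfolding p_capacity_in_energy by (intro INF_lower) auto

lemma le_p_capacity_in:
  "(\<And>u. u \<in> test_fun D \<Longrightarrow> (\<And>x. x \<in> F \<Longrightarrow> 1 \<le> u x) \<Longrightarrow> b \<le> energy p u) \<Longrightarrow> b \<le> p_capacity_in D p F"
  unfolding p_capacity_in_energy by (intro INF_greatest) auto

lemma ennreal_le_mult_cancel:
  assumes "0 < C" "0 \<le> a" "ennreal a * I \<le> ennreal C * E"
  shows "ennreal (a / C) * I \<le> E"
proof -
  have "ennreal (1 / C) * (ennreal a * I) \<le> ennreal (1 / C) * (ennreal C * E)"
    by (intro mult_left_mono assms) simp
  moreover have "ennreal (1 / C) * (ennreal C * E) = E"
    using assms(1) by (simp flip: mult.assoc ennreal_mult)
  moreover have "ennreal (1 / C) * (ennreal a * I) = ennreal (a / C) * I"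
    using assms(1,2) by (simp flip: mult.assoc ennreal_mult)
  ultimately show ?thesis by simp
qed

lemma powr_sum_le:
  fixes a b p :: real
  assumes "0 \<le> a" "0 \<le> b" "0 \<le> p"
  shows "(a + b) powr p \<le> 2 powr p * (a powr p + b powr p)"
proof -
  have "(a + b) powr p \<le> (2 * max a b) powr p"
    using assms by (intro powr_mono2) auto
  also have "\<dots> = 2 powr p * max a b powr p"
    using assms by (simp add: powr_mult)
  also have "max a b powr p \<le> a powr p + b powr p"
    by (simp add: max_def)
  finally show ?thesis by simp
qed

lemma energy_finite:
  assumes "u \<in> test_fun D" "0 < p"
  shows "energy p u < top"
proof -
  obtain M where M: "\<And>x. norm (grad u x) \<le> M"
    using assms by (elim test_fun_grad_bounded) blast
  obtain K where K: "compact K" "\<And>x. x \<notin> K \<Longrightarrow> grad u x = 0"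
    using assms by (elim test_funE) blast
  have "energy p u \<le> (\<integral>\<^sup>+x. ennreal (M powr p) * indicator K x \<partial>lborel)"
    unfolding energy_def
  proof (rule nn_integral_mono)
    fix x show "ennreal (norm (grad u x) powr p) \<le> ennreal (M powr p) * indicator K x"
      using M[of x] K(2)[of x] assms(2)
      by (cases "x \<in> K") (auto intro!: ennreal_leI powr_mono2)
  qed
  also have "\<dots> = ennreal (M powr p) * emeasure lborel K"
    using K(1) by (simp add: nn_integral_cmult compact_imp_closed borel_closed)
  also have "\<dots> < top"
    using emeasure_bounded_finite[OF compact_imp_bounded[OF K(1)]] by (simp add: ennreal_mult_less_top)
  finally show ?thesis .
qed

section \<open>Scaling to the unit ball\<close>

text \<open>The ambient set of \<open>ball_capacity\<close> after scaling. Both branches contain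
  \<open>ball 0 2\<close>, where all cutoffs live, so most arguments need not distinguish
  them.\<close>

definition unit_domain :: "real \<Rightarrow> (real^'n) set" where
  "unit_domain p = (if p < real CARD('n) then UNIV else ball 0 2)"

definition unit_capacity :: "real \<Rightarrow> (real^'n) set \<Rightarrow> ennreal" where
  "unit_capacity p F = p_capacity_in (unit_domain p) p F"

lemma ball_subset_unit_domain: "ball 0 2 \<subseteq> unit_domain p"
  by (simp add: unit_domain_def)

lemma test_fun_affine:
  fixes u :: "real^'n \<Rightarrow> real"
  assumes "u \<in> test_fun D" "0 < r"
  shows "(\<lambda>x. u (c + r *\<^sub>R x)) \<in> test_fun {x. c + r *\<^sub>R x \<in> D}"
proof -
  obtain K where K: "compact K" "K \<subseteq> D" "\<And>x. x \<notin> K \<Longrightarrow> u x = 0"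
    using assms(1) by (elim test_funE) blast
  let ?g = "\<lambda>y. (1 / r) *\<^sub>R (y - c)"
  have "c + r *\<^sub>R x \<in> K \<Longrightarrow> x \<in> ?g ` K" for x
    using assms(2) by (intro image_eqI[where x = "c + r *\<^sub>R x"]) auto
  moreover have "compact (?g ` K)"
    by (intro compact_continuous_image continuous_intros K)
  ultimately show ?thesis
    using K assms by (intro test_funI[where K = "?g ` K"] smooth_affine test_fun_smooth[OF assms(1)]) auto
qed

text \<open>The gradient contributes r^p and the change of variables r^(-n). The exponent vanishes
  in the conformal case p = n.\<close>

lemma energy_affine:
  fixes u :: "real^'n \<Rightarrow> real"
  assumes "smooth u" "0 < r"
  shows "energy p (\<lambda>x. u (c + r *\<^sub>R x)) = ennreal (r powr (p - real CARD('n))) * energy p u"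
proof -
  have [measurable]: "grad u \<in> borel_measurable borel"
    by (rule smooth_grad_measurable[OF assms(1)])
  let ?f = "\<lambda>x. ennreal (norm (grad u x) powr p)"
  have f: "?f \<in> borel_measurable borel" by measurable
  have [measurable]: "(\<lambda>x. ?f (c + r *\<^sub>R x)) \<in> borel_measurable borel" by measurable
  have "energy p (\<lambda>x. u (c + r *\<^sub>R x)) = (\<integral>\<^sup>+x. ennreal (r powr p) * ?f (c + r *\<^sub>R x) \<partial>lborel)"
    unfolding energy_def grad_affine[OF assms(1)]
    using assms(2) by (simp add: powr_mult flip: ennreal_mult)
  also have "\<dots> = ennreal (r powr p) * (\<integral>\<^sup>+x. ?f (c + r *\<^sub>R x) \<partial>lborel)"
    by (rule nn_integral_cmult) measurable
  also have "\<dots> = ennreal (r powr p) * (ennreal (inverse r ^ CARD('n)) * energy p u)"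
    using nn_integral_affine[OF f assms(2), of c] by (simp add: energy_def)
  also have "\<dots> = ennreal (r powr (p - real CARD('n))) * energy p u"
    using assms(2) by (simp add: powr_diff powr_realpow field_simps flip: mult.assoc ennreal_mult)
  finally show ?thesis .
qed

lemma p_capacity_in_affine_le:
  fixes D :: "(real^'n) set"
  assumes "0 < r"
  shows "p_capacity_in {x. c + r *\<^sub>R x \<in> D} p {x. c + r *\<^sub>R x \<in> F} \<le>
    ennreal (r powr (p - real CARD('n))) * p_capacity_in D p F"
proof -
  let ?L = "p_capacity_in {x. c + r *\<^sub>R x \<in> D} p {x. c + r *\<^sub>R x \<in> F}"
  let ?q = "r powr (p - real CARD('n))"
  have "ennreal (1 / ?q) * ?L \<le> p_capacity_in D p F"
  proof (rule le_p_capacity_in)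
    fix u assume u: "u \<in> test_fun D" "\<And>x. x \<in> F \<Longrightarrow> 1 \<le> u x"
    have "?L \<le> energy p (\<lambda>x. u (c + r *\<^sub>R x))"
      using u by (intro p_capacity_in_le test_fun_affine assms) auto
    also have "\<dots> = ennreal ?q * energy p u"
      by (rule energy_affine[OF test_fun_smooth[OF u(1)] assms])
    finally have "ennreal 1 * ?L \<le> ennreal ?q * energy p u" by simp
    then show "ennreal (1 / ?q) * ?L \<le> energy p u"
      using assms by (intro ennreal_le_mult_cancel) auto
  qed
  then have "ennreal ?q * (ennreal (1 / ?q) * ?L) \<le> ennreal ?q * p_capacity_in D p F"
    by (intro mult_left_mono) auto
  then show ?thesis
    using assms by (simp flip: mult.assoc ennreal_mult)
qed

text \<open>The missing inequality is the one-sided bound applied to the inverse affine map.\<close>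

lemma p_capacity_in_affine:
  fixes D :: "(real^'n) set"
  assumes "0 < r"
  shows "p_capacity_in {x. c + r *\<^sub>R x \<in> D} p {x. c + r *\<^sub>R x \<in> F} =
    ennreal (r powr (p - real CARD('n))) * p_capacity_in D p F"
proof (rule antisym)
  let ?L = "p_capacity_in {x. c + r *\<^sub>R x \<in> D} p {x. c + r *\<^sub>R x \<in> F}"
  let ?q = "r powr (p - real CARD('n))"
  have "p_capacity_in {x. (- (1 / r) *\<^sub>R c) + (1 / r) *\<^sub>R x \<in> {x. c + r *\<^sub>R x \<in> D}} p
         {x. (- (1 / r) *\<^sub>R c) + (1 / r) *\<^sub>R x \<in> {x. c + r *\<^sub>R x \<in> F}} \<le>
    ennreal ((1 / r) powr (p - real CARD('n))) * ?L"
    using assms by (intro p_capacity_in_affine_le) auto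
  moreover have "{x. (- (1 / r) *\<^sub>R c) + (1 / r) *\<^sub>R x \<in> {x. c + r *\<^sub>R x \<in> G}} = G" for G
    using assms by (auto simp: algebra_simps)
  ultimately have "p_capacity_in D p F \<le> ennreal (1 / ?q) * ?L"
    using assms by (simp add: powr_divide)
  then have "ennreal ?q * p_capacity_in D p F \<le> ennreal ?q * (ennreal (1 / ?q) * ?L)"
    by (intro mult_left_mono) auto
  then show "ennreal ?q * p_capacity_in D p F \<le> ?L"
    using assms by (simp flip: mult.assoc ennreal_mult)
qed (rule p_capacity_in_affine_le[OF assms])

lemma ball_capacity_affine:
  fixes F :: "(real^'n) set"
  assumes "0 < r"
  shows "unit_capacity p {x. c + r *\<^sub>R x \<in> F} =
    ennreal (r powr (p - real CARD('n))) * ball_capacity p c r F"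
proof -
  have "{x. c + r *\<^sub>R x \<in> ball c (2 * r)} = ball 0 2"
    using assms by (auto simp: dist_norm)
  then show ?thesis
    using p_capacity_in_affine[OF assms, of c UNIV p F]
      p_capacity_in_affine[OF assms, of c "ball c (2 * r)" p F]
    by (auto simp: unit_capacity_def unit_domain_def ball_capacity_def)
qed

text \<open>Both capacities acquire the same positive finite factor under scaling, and it
  cancels.\<close>

lemma negligible_in_iff:
  fixes \<Omega> :: "(real^'n) set"
  assumes "0 < r" "open \<Omega>" "0 \<le> \<gamma>"
  shows "negligible_in p \<gamma> c r (cball c r - \<Omega>) \<longleftrightarrow>
    unit_capacity p (cball 0 1 - {x. c + r *\<^sub>R x \<in> \<Omega>}) \<le>
    ennreal \<gamma> * unit_capacity p (cball 0 1 :: (real^'n) set)"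
proof -
  let ?q = "r powr (p - real CARD('n))"
  have q: "0 < ?q" using assms by simp
  have cb: "{x. c + r *\<^sub>R x \<in> cball c r} = cball 0 1"
    using assms by (auto simp: dist_norm)
  then have "{x. c + r *\<^sub>R x \<in> cball c r - \<Omega>} = cball 0 1 - {x. c + r *\<^sub>R x \<in> \<Omega>}"
    by auto
  then have 1: "unit_capacity p (cball 0 1 - {x. c + r *\<^sub>R x \<in> \<Omega>}) = ennreal ?q * ball_capacity p c r (cball c r - \<Omega>)"
    using ball_capacity_affine[OF assms(1), of p c "cball c r - \<Omega>"] by simp
  have 2: "ennreal \<gamma> * unit_capacity p (cball 0 1 :: (real^'n) set) = ennreal ?q * (ennreal \<gamma> * ball_capacity p c r (cball c r))"
    using ball_capacity_affine[OF assms(1), of p c "cball c r"] unfolding cb by (simp add: ac_simps)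
  have "compact (cball c r - \<Omega>)"
    using assms by (intro compact_diff) auto
  then have "negligible_in p \<gamma> c r (cball c r - \<Omega>) \<longleftrightarrow>
      ball_capacity p c r (cball c r - \<Omega>) \<le> ennreal \<gamma> * ball_capacity p c r (cball c r)"
    by (auto simp: negligible_in_def)
  also have "\<dots> \<longleftrightarrow> ennreal ?q * ball_capacity p c r (cball c r - \<Omega>) \<le>
      ennreal ?q * (ennreal \<gamma> * ball_capacity p c r (cball c r))"
    using q ennreal_mult_le_mult_iff[of "ennreal ?q"] by simp
  finally show ?thesis
    by (simp only: 1 2)
qed

section \<open>The unit ball has finite and positive capacity\<close>

lemma unit_capacity_finite:
  assumes "0 < p"
  shows "unit_capacity p (cball 0 1 :: (real^'n) set) < top"
proof -
  obtain \<theta> :: "real^'n \<Rightarrow> real" where \<theta>: "\<theta> \<in> test_fun (ball 0 2)" "\<forall>x\<in>cball 0 1. \<theta> x = 1"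
    using ex_cutoff[of 1 2, where 'n = 'n] by auto
  then have "unit_capacity p (cball 0 1 :: (real^'n) set) \<le> energy p \<theta>"
    unfolding unit_capacity_def
    by (intro p_capacity_in_le test_fun_mono[OF _ ball_subset_unit_domain]) auto
  also have "\<dots> < top"
    using \<theta> assms by (intro energy_finite)
  finally show ?thesis .
qed

text \<open>Positivity of each single energy would not exclude the infimum 0, so one bound
  \<open>b / C\<close> has to serve all competitors.\<close>

lemma unit_capacity_pos_aux:
  assumes "0 < b" "0 < C" "\<And>u :: real^'n \<Rightarrow> real. u \<in> test_fun (unit_domain p) \<Longrightarrow>
     (\<And>x. x \<in> cball 0 1 \<Longrightarrow> 1 \<le> u x) \<Longrightarrow> ennreal b \<le> ennreal C * energy p u"
  shows "0 < unit_capacity p (cball 0 1 :: (real^'n) set)"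
proof -
  have "ennreal (b / C) \<le> unit_capacity p (cball 0 1 :: (real^'n) set)"
    unfolding unit_capacity_def
  proof (rule le_p_capacity_in)
    fix u :: "real^'n \<Rightarrow> real"
    assume "u \<in> test_fun (unit_domain p)" "\<And>x. x \<in> cball 0 1 \<Longrightarrow> 1 \<le> u x"
    then have "ennreal b * 1 \<le> ennreal C * energy p u"
      using assms(3) by simp
    then show "ennreal (b / C) \<le> energy p u"
      using ennreal_le_mult_cancel[of C b 1] assms by simp
  qed
  then show ?thesis
    using assms(1,2) by (metis divide_pos_pos ennreal_less_zero_iff less_le_trans)
qed

text \<open>The bound is free of \<open>N\<close>, which will depend on the support of the
  competitor.\<close>

lemma nn_integral_power_tail:
  assumes "1 \<le> N" "0 < s"
  shows "(\<integral>\<^sup>+R\<in>{1..N}. ennreal (R powr (- 1 - s)) \<partial>lborel) \<le> ennreal (1 / s)"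
proof -
  have "((\<lambda>R. R powr (- 1 - s)) has_integral (- (1 / s) * N powr (- s) - (- (1 / s)) * 1 powr (- s))) {1..N}"
  proof (rule fundamental_theorem_of_calculus)
    fix R assume "R \<in> {1..N}"
    then have "((\<lambda>R. - (1 / s) * R powr (- s)) has_real_derivative - (1 / s) * (- s * R powr (- s - 1))) (at R)"
      by (intro DERIV_cmult has_real_derivative_powr) auto
    then have "((\<lambda>R. - (1 / s) * R powr (- s)) has_real_derivative R powr (- 1 - s)) (at R)"
      using assms by (simp add: minus_diff_commute)
    then show "((\<lambda>R. - (1 / s) * R powr (- s)) has_vector_derivative R powr (- 1 - s)) (at R within {1..N})"
      by (simp add: has_field_derivative_at_within has_real_derivative_iff_has_vector_derivative[symmetric])
  qed fact
  from nn_integral_has_integral_lebesgue'[OF _ this]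
  have "(\<integral>\<^sup>+R\<in>{1..N}. ennreal (R powr (- 1 - s)) \<partial>lborel) =
      ennreal (- (1 / s) * N powr (- s) - (- (1 / s)) * 1 powr (- s))" by simp
  also have "\<dots> \<le> ennreal (1 / s)"
    using assms by (intro ennreal_leI) simp
  finally show ?thesis .
qed

text \<open>Competitors live in \<open>ball 0 2\<close>, so a fixed translation moves the unit ball
  off their support. There the difference of the function and its translate is at least 1 in
  absolute value, and the translation estimate applies.\<close>

lemma unit_capacity_pos_conformal:
  assumes "1 \<le> p" "\<not> p < real CARD('n)"
  shows "0 < unit_capacity p (cball 0 1 :: (real^'n) set)"
proof (rule unit_capacity_pos_aux)
  define b where "b = measure lborel (cball 0 1 :: (real^'n) set)"
  have b: "emeasure lborel (cball 0 1 :: (real^'n) set) = ennreal b"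
    by (simp add: b_def emeasure_cball measure_def)
  show "0 < measure lborel (cball 0 1 :: (real^'n) set)"
    by (simp add: content_cball)
  show "0 < (8::real) powr p" by simp
  fix u :: "real^'n \<Rightarrow> real"
  assume u: "u \<in> test_fun (unit_domain p)" "\<And>x. x \<in> cball 0 1 \<Longrightarrow> 1 \<le> u x"
  have z: "u x = 0" if "2 \<le> norm x" for x
  proof -
    obtain K where K: "K \<subseteq> unit_domain p" "\<And>x. x \<notin> K \<Longrightarrow> u x = 0"
      using test_funE[OF u(1)] by metis
    have "x \<notin> K"
      using K(1) assms(2) that by (auto simp: unit_domain_def)
    then show ?thesis by (rule K(2))
  qed
  \<comment> \<open>Length 4 is enough: |x + h| is at least 3 for x in the unit ball. It yields the
    constant 8 = 2 * 4.\<close>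
  define h :: "real^'n" where "h = 4 *\<^sub>R axis undefined 1"
  have h: "norm h = 4" by (simp add: h_def)
  have "ennreal b = (\<integral>\<^sup>+x. indicator (cball 0 1 :: (real^'n) set) x \<partial>lborel)"
    by (simp add: b)
  also have "\<dots> \<le> (\<integral>\<^sup>+x. ennreal (\<bar>u (x + h) - u x\<bar> powr p) \<partial>lborel)"
  proof (rule nn_integral_mono)
    fix x :: "real^'n"
    show "indicator (cball 0 1) x \<le> ennreal (\<bar>u (x + h) - u x\<bar> powr p)"
    proof (cases "x \<in> cball 0 1")
      case True
      then have "norm h \<le> norm (x + h) + 1"
        using norm_triangle_ineq4[of "x + h" x] by simp
      then have "u (x + h) = 0" using z h by simp
      then have "1 powr p \<le> \<bar>u (x + h) - u x\<bar> powr p"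
        using u(2)[OF True] assms by (intro powr_mono2) auto
      then show ?thesis using True ennreal_leI[of 1] by simp
    qed simp
  qed
  also have "\<dots> \<le> ennreal ((2 * norm h) powr p) * energy p u"
    by (rule translation_estimate[OF test_fun_smooth[OF u(1)] assms(1)])
  finally show "ennreal (measure lborel (cball 0 1 :: (real^'n) set)) \<le> ennreal (8 powr p) * energy p u"
    by (simp add: h b_def)
qed

text \<open>Along each ray issuing from a fixed small ball inside the unit ball, $u$ drops from $1$ to $0$.
  Young's inequality with the weight $R^{-\beta}$, where $1 < \beta < (n-1)/(p-1)$, turns the
  resulting bound on the radial integral of the gradient into a bound on the energy.\<close>

lemma unit_capacity_pos_subconformal:
  assumes "1 < p" "p < real CARD('n)"
  shows "0 < unit_capacity p (cball 0 1 :: (real^'n) set)"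
proof -
  let ?n = "real CARD('n)"
  define Q where "Q = (?n - 1) / (p - 1)"
  \<comment> \<open>The midpoint of 1 and \<open>Q\<close>; the interval is nonempty because p <
    n.\<close>
  define \<beta> where "\<beta> = (1 + Q) / 2"
  have "1 < Q" using assms by (simp add: Q_def)
  then have \<beta>: "1 < \<beta>" "\<beta> < (?n - 1) / (p - 1)"
    unfolding Q_def[symmetric] by (auto simp: \<beta>_def)
  \<comment> \<open>The surplus in the exponent of R after integration over h, positive because
    \<beta> < \<open>Q\<close>.\<close>
  define \<sigma> where "\<sigma> = ?n - 1 - \<beta> * (p - 1)"
  have \<sigma>: "0 < \<sigma>" using \<beta>(2) assms by (simp add: \<sigma>_def field_simps)
  \<comment> \<open>The weight \<open>e * R powr (- \<beta>)\<close> then has integral at most 1/2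
    over R \<ge> 1, so half of the drop of \<open>u\<close> remains.\<close>
  define e where "e = (\<beta> - 1) / 2"
  have e: "0 < e" using \<beta> by (simp add: e_def)
  \<comment> \<open>The ball of radius 1/4 about \<open>x0\<close> lies in the unit ball, where u
    \<ge> 1, and stays at distance 1/2 from the origin, so one \<open>N\<close> takes all its points
    beyond the support of \<open>u\<close>.\<close>
  define x0 :: "real^'n" where "x0 = (3/4) *\<^sub>R axis undefined 1"
  have x0: "norm x0 = 3/4" by (simp add: x0_def)
  define B where "B = ball x0 (1/4)"
  define b where "b = measure lborel B"
  have b: "emeasure lborel B = ennreal b" "0 < b"
    by (simp_all add: b_def B_def emeasure_ball measure_def content_ball)
  have [measurable]: "B \<in> sets borel" by (simp add: B_def)
  have Bn: "norm h \<le> 1" "1/2 \<le> norm h" if "h \<in> B" for h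
    using that x0 norm_triangle_ineq2[of h x0] norm_triangle_ineq2[of x0 h]
    by (auto simp: B_def dist_norm norm_minus_commute)
  show ?thesis
  proof (rule unit_capacity_pos_aux)
    show "0 < b / 2" using b by simp
    show "0 < e powr (1 - p) / \<sigma>" using e \<sigma> by simp
    fix u :: "real^'n \<Rightarrow> real"
    assume u: "u \<in> test_fun (unit_domain p)" "\<And>x. x \<in> cball 0 1 \<Longrightarrow> 1 \<le> u x"
    have su: "smooth u" by (rule test_fun_smooth[OF u(1)])
    have [measurable]: "grad u \<in> borel_measurable borel"
      by (rule smooth_grad_measurable[OF su])
    obtain K where K: "compact K" "\<And>x. x \<notin> K \<Longrightarrow> u x = 0"
      using u(1) by (elim test_funE) blast
    then obtain N0 where N0: "\<And>x. x \<in> K \<Longrightarrow> norm x \<le> N0"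
      by (meson bounded_iff compact_imp_bounded)
    define N where "N = max 1 (2 * N0 + 1)"
    have N: "1 \<le> N" by (simp add: N_def)
    define J where "J = (\<lambda>h R. ennreal (e powr (1 - p) * R powr (\<beta> * (p - 1))) *
       (ennreal (norm (grad u (R *\<^sub>R h)) powr p) * indicator {1..N} R))"
    have half: "ennreal (1/2) \<le> (\<integral>\<^sup>+R. J h R \<partial>lborel)" if h: "h \<in> B" for h
    proof -
      have "N0 < N * norm h"
      proof -
        have "2 * N0 + 1 \<le> N" by (simp add: N_def)
        moreover have "N * (1/2) \<le> N * norm h"
          using Bn(2)[OF h] N by (intro mult_left_mono) auto
        ultimately show ?thesis by linarith
      qed
      then have "u (N *\<^sub>R h) = 0"
        using N0[of "N *\<^sub>R h"] K(2) N by fastforce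
      moreover have "1 \<le> u (1 *\<^sub>R h)"
        using u(2)[of h] Bn(1)[OF h] by simp
      ultimately have "1 \<le> \<bar>u (0 + N *\<^sub>R h) - u (0 + 1 *\<^sub>R h)\<bar>" by simp
      then have "ennreal 1 \<le> ennreal \<bar>u (0 + N *\<^sub>R h) - u (0 + 1 *\<^sub>R h)\<bar>"
        by (rule ennreal_leI)
      also have "\<dots> \<le> (\<integral>\<^sup>+R\<in>{1..N}. ennreal \<bar>grad u (0 + R *\<^sub>R h) \<bullet> h\<bar> \<partial>lborel)"
      proof (rule nn_integral_FTC_abs_le[OF N line_has_derivative[OF su]])
        show "continuous_on UNIV (\<lambda>R. grad u (0 + R *\<^sub>R h) \<bullet> h)"
          by (intro continuous_on_inner continuous_on_compose2[OF smooth_continuous_grad[OF su, of UNIV]])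
             (auto intro!: continuous_intros)
      qed
      also have "\<dots> \<le> (\<integral>\<^sup>+R. ennreal e * (ennreal (R powr (- 1 - (\<beta> - 1))) * indicator {1..N} R) + J h R \<partial>lborel)"
      proof (rule nn_integral_mono)
        fix R :: real
        show "ennreal \<bar>grad u (0 + R *\<^sub>R h) \<bullet> h\<bar> * indicator {1..N} R \<le>
          ennreal e * (ennreal (R powr (- 1 - (\<beta> - 1))) * indicator {1..N} R) + J h R"
        proof (cases "R \<in> {1..N}")
          case True
          then have R: "0 < R" by auto
          let ?g = "norm (grad u (R *\<^sub>R h))"
          have "\<bar>grad u (0 + R *\<^sub>R h) \<bullet> h\<bar> \<le> ?g * norm h"
            using Cauchy_Schwarz_ineq2[of "grad u (R *\<^sub>R h)" h] by simp
          also have "\<dots> \<le> ?g"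
            using Bn(1)[OF h] by (simp add: mult_left_le)
          also have "\<dots> \<le> e * R powr (- \<beta>) + (e * R powr (- \<beta>)) powr (1 - p) * ?g powr p"
            using R e assms by (intro young_powr) auto
          also have "(e * R powr (- \<beta>)) powr (1 - p) = e powr (1 - p) * R powr (\<beta> * (p - 1))"
            using R e by (simp add: powr_mult powr_powr algebra_simps)
          finally have "ennreal \<bar>grad u (0 + R *\<^sub>R h) \<bullet> h\<bar> \<le>
            ennreal (e * R powr (- \<beta>) + e powr (1 - p) * R powr (\<beta> * (p - 1)) * ?g powr p)"
            by (rule ennreal_leI)
          then show ?thesis
            using True e by (simp add: J_def ennreal_mult)
        qed (simp add: J_def)
      qed
      also have "\<dots> = ennreal e * (\<integral>\<^sup>+R\<in>{1..N}. ennreal (R powr (- 1 - (\<beta> - 1))) \<partial>lborel) + (\<integral>\<^sup>+R. J h R \<partial>lborel)"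
        unfolding J_def by (subst nn_integral_add) (auto simp: nn_integral_cmult)
      also have "\<dots> \<le> ennreal e * ennreal (1 / (\<beta> - 1)) + (\<integral>\<^sup>+R. J h R \<partial>lborel)"
        using \<beta> N by (intro add_right_mono mult_left_mono nn_integral_power_tail) auto
      also have "ennreal e * ennreal (1 / (\<beta> - 1)) = ennreal (1/2)"
      proof -
        have "e * (1 / (\<beta> - 1)) = 1/2" using \<beta> by (simp add: e_def field_simps)
        then show ?thesis using \<beta> e by (metis ennreal_mult' less_imp_le)
      qed
      finally have "ennreal 1 \<le> ennreal (1/2) + ennreal 1 * (\<integral>\<^sup>+R. J h R \<partial>lborel)" by simp
      then show ?thesis
        using ennreal_le_half_add[of 1 1] by simp
    qed
    \<comment> \<open>The dilation by R contributes R^(-n); with Young's weight the exponent becomes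
      -1 - \<sigma>, which is integrable at infinity.\<close>
    have scale: "(\<integral>\<^sup>+h. J h R \<partial>lborel) =
       ennreal (e powr (1 - p)) * energy p u * (ennreal (R powr (- 1 - \<sigma>)) * indicator {1..N} R)" for R
    proof (cases "R \<in> {1..N}")
      case True
      then have R: "0 < R" by auto
      have m: "(\<lambda>x. ennreal (norm (grad u x) powr p)) \<in> borel_measurable borel" by measurable
      have "(\<integral>\<^sup>+h. J h R \<partial>lborel) = ennreal (e powr (1 - p) * R powr (\<beta> * (p - 1))) *
         (\<integral>\<^sup>+h. ennreal (norm (grad u (0 + R *\<^sub>R h)) powr p) \<partial>lborel)"
        using True by (simp add: J_def nn_integral_cmult)
      also have "(\<integral>\<^sup>+h. ennreal (norm (grad u (0 + R *\<^sub>R h)) powr p) \<partial>lborel) =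
          ennreal (inverse R ^ CARD('n)) * energy p u"
        using nn_integral_affine[OF m R, of 0] by (simp add: energy_def)
      also have "inverse R ^ CARD('n) = R powr (- ?n)"
        using R by (simp add: powr_minus powr_realpow power_inverse)
      also have "ennreal (e powr (1 - p) * R powr (\<beta> * (p - 1))) * (ennreal (R powr (- ?n)) * energy p u) =
          ennreal (e powr (1 - p) * (R powr (\<beta> * (p - 1)) * R powr (- ?n))) * energy p u"
        by (simp add: mult.assoc flip: ennreal_mult mult.assoc[of "ennreal _" "ennreal _"])
      also have "R powr (\<beta> * (p - 1)) * R powr (- ?n) = R powr (- 1 - \<sigma>)"
        using R by (simp add: \<sigma>_def flip: powr_add)
      finally show ?thesis
        using True by (simp add: ennreal_mult ac_simps)
    qed (simp add: J_def)
    have Jm: "case_prod J \<in> borel_measurable (lborel \<Otimes>\<^sub>M lborel)"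
      unfolding J_def by measurable
    have [measurable]: "(\<lambda>h. \<integral>\<^sup>+R. J h R \<partial>lborel) \<in> borel_measurable lborel"
      unfolding J_def by measurable
    have "ennreal (b / 2) = (\<integral>\<^sup>+h\<in>B. ennreal (1/2) \<partial>lborel)"
      using b ennreal_mult[of "1/2" b] by (simp add: nn_integral_cmult)
    also have "\<dots> \<le> (\<integral>\<^sup>+h. (\<integral>\<^sup>+R. J h R \<partial>lborel) \<partial>lborel)"
      using half by (intro nn_integral_mono) (auto simp: indicator_def)
    also have "\<dots> = (\<integral>\<^sup>+R. (\<integral>\<^sup>+h. J h R \<partial>lborel) \<partial>lborel)"
      by (rule lborel_pair.Fubini'[OF Jm, symmetric])
    also have "\<dots> = ennreal (e powr (1 - p)) * energy p u * (\<integral>\<^sup>+R\<in>{1..N}. ennreal (R powr (- 1 - \<sigma>)) \<partial>lborel)"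
      unfolding scale by (intro nn_integral_cmult) measurable
    also have "\<dots> \<le> ennreal (e powr (1 - p)) * energy p u * ennreal (1 / \<sigma>)"
      using \<sigma> N by (intro mult_left_mono nn_integral_power_tail) auto
    also have "\<dots> = ennreal (e powr (1 - p) / \<sigma>) * energy p u"
      using \<sigma> by (simp add: divide_inverse ennreal_mult ac_simps)
    finally show "ennreal (b / 2) \<le> ennreal (e powr (1 - p) / \<sigma>) * energy p u" .
  qed
qed

text \<open>Positivity keeps the lower bound non-degenerate; together with finiteness it also makes
  multiplication by \<gamma> a strict decrease in the upper bound.\<close>

lemma unit_capacity_real:
  assumes "1 < p"
  obtains k where "0 < k" "unit_capacity p (cball 0 1 :: (real^'n) set) = ennreal k"
proof -
  have "0 < unit_capacity p (cball 0 1 :: (real^'n) set)"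
    using assms unit_capacity_pos_conformal[of p, where 'n = 'n]
      unit_capacity_pos_subconformal[of p, where 'n = 'n] by fastforce
  moreover have "unit_capacity p (cball 0 1 :: (real^'n) set) < top"
    using assms by (intro unit_capacity_finite) simp
  ultimately show ?thesis
    using that by (cases "unit_capacity p (cball 0 1 :: (real^'n) set)") (auto simp: ennreal_less_zero_iff)
qed

section \<open>The lower bound\<close>

lemma norm_grad_scaled_mult_le:
  assumes "smooth \<theta>" "smooth v" "\<bar>\<theta> x\<bar> \<le> 1" "norm (grad \<theta> x) \<le> M"
  shows "norm (grad (\<lambda>x. \<theta> x * v x) x) \<le> M * \<bar>v x\<bar> + norm (grad v x)"
proof -
  have "norm (grad (\<lambda>x. \<theta> x * v x) x) \<le> \<bar>\<theta> x\<bar> * norm (grad v x) + \<bar>v x\<bar> * norm (grad \<theta> x)"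
    unfolding grad_mult[OF assms(1,2)[THEN smooth_differentiable]]
    by (rule norm_triangle_le) simp
  also have "\<dots> \<le> 1 * norm (grad v x) + \<bar>v x\<bar> * M"
    using assms by (intro add_mono mult_mono) auto
  finally show ?thesis by (simp add: mult.commute)
qed

text \<open>The competitor is $\theta(y)\,(1 - u(c + r y)/u(c))$, which equals $1$ on the part of the unit
  ball that $c + r\,\cdot$ maps outside $\Omega$.\<close>

lemma pointwise_lower_bound:
  fixes \<theta> u :: "real^'n \<Rightarrow> real"
  assumes "1 < p" "0 \<le> \<gamma>" and \<theta>: "\<theta> \<in> test_fun (ball 0 2)" "\<And>x. 0 \<le> \<theta> x" "\<And>x. \<theta> x \<le> 1"
      "\<And>x. x \<in> cball 0 1 \<Longrightarrow> \<theta> x = 1"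
    and M: "1 \<le> M" "\<And>x. norm (grad \<theta> x) \<le> M"
    and "open \<Omega>" "0 < r" and u: "u \<in> test_fun \<Omega>"
    and "\<not> negligible_in p \<gamma> c r (cball c r - \<Omega>)"
  shows "ennreal (\<bar>u c\<bar> powr p) * (ennreal \<gamma> * unit_capacity p (cball 0 1 :: (real^'n) set)) \<le>
    ennreal ((2 * M) powr p) * (\<integral>\<^sup>+y\<in>ball 0 2. (ennreal (\<bar>u (c + r *\<^sub>R y) - u c\<bar> powr p) +
       ennreal (r powr p) * ennreal (norm (grad u (c + r *\<^sub>R y)) powr p)) \<partial>lborel)"
proof (cases "u c = 0")
  case False
  have su: "smooth u" by (rule test_fun_smooth[OF u])
  have s\<theta>: "smooth \<theta>" by (rule test_fun_smooth[OF \<theta>(1)])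
  have [measurable]: "grad u \<in> borel_measurable borel" "u \<in> borel_measurable borel"
    using smooth_grad_measurable[OF su] smooth_measurable[OF su] by auto
  define a where "a = - inverse (u c)"
  have a: "a * u c = - 1" using False by (simp add: a_def)
  define v where "v = (\<lambda>y. 1 + a * u (c + r *\<^sub>R y))"
  define w where "w = (\<lambda>y. \<theta> y * v y)"
  have sa: "smooth (\<lambda>y. u (c + r *\<^sub>R y))"
    by (rule smooth_affine[OF su])
  have sv: "smooth v"
    unfolding v_def by (rule smooth_add[OF smooth_const smooth_mult[OF smooth_const sa]])
  have gv: "grad v y = (a * r) *\<^sub>R grad u (c + r *\<^sub>R y)" for y
    unfolding v_def
    by (simp add: grad_add grad_mult grad_affine[OF su] smooth_differentiable[OF smooth_const]
        smooth_differentiable[OF sa] smooth_differentiable[OF smooth_mult[OF smooth_const sa]])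
  obtain K where K: "compact K" "K \<subseteq> ball 0 2" "\<And>x. x \<notin> K \<Longrightarrow> \<theta> x = 0" "\<And>x. x \<notin> K \<Longrightarrow> grad \<theta> x = 0"
    using test_funE[OF \<theta>(1)] by metis
  have sw: "smooth w"
    unfolding w_def by (rule smooth_mult[OF s\<theta> sv])
  have tw: "w \<in> test_fun (ball 0 2)"
    using K sw by (intro test_funI[of w K]) (auto simp: w_def)
  have gw0: "grad w y = 0" if "y \<notin> ball 0 2" for y
  proof -
    have "y \<notin> K" using that K by auto
    then show ?thesis
      unfolding w_def using K(3,4)
      by (simp add: grad_mult smooth_differentiable[OF s\<theta>] smooth_differentiable[OF sv])
  qed
  have uz: "u x = 0" if "x \<notin> \<Omega>" for x
    using test_funE[OF u] that by (metis subsetD)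
  have "ennreal \<gamma> * unit_capacity p (cball 0 1 :: (real^'n) set) \<le> unit_capacity p (cball 0 1 - {x. c + r *\<^sub>R x \<in> \<Omega>})"
    using assms by (simp add: negligible_in_iff)
  also have "\<dots> \<le> energy p w"
    unfolding unit_capacity_def
  proof (rule p_capacity_in_le)
    show "w \<in> test_fun (unit_domain p)"
      by (rule test_fun_mono[OF tw ball_subset_unit_domain])
    show "1 \<le> w x" if "x \<in> cball 0 1 - {x. c + r *\<^sub>R x \<in> \<Omega>}" for x
      using that \<theta>(4)[of x] uz[of "c + r *\<^sub>R x"] by (simp add: w_def v_def)
  qed
  finally have 1: "ennreal \<gamma> * unit_capacity p (cball 0 1 :: (real^'n) set) \<le> energy p w" .
  \<comment> \<open>Multiplication by |u(c)|^p clears the denominator of \<open>v\<close>, so only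
    the difference u(c + r y) - u(c) and the gradient of \<open>u\<close> remain.\<close>
  have 2: "\<bar>u c\<bar> powr p * norm (grad w y) powr p \<le>
      (2 * M) powr p * (\<bar>u (c + r *\<^sub>R y) - u c\<bar> powr p + r powr p * norm (grad u (c + r *\<^sub>R y)) powr p)" for y
  proof -
    let ?a = "\<bar>u (c + r *\<^sub>R y) - u c\<bar>" and ?b = "r * norm (grad u (c + r *\<^sub>R y))"
    have "norm (grad w y) \<le> M * \<bar>v y\<bar> + norm (grad v y)"
      unfolding w_def using \<theta>(2,3)[of y] by (intro norm_grad_scaled_mult_le s\<theta> sv M(2)) auto
    then have "\<bar>u c\<bar> * norm (grad w y) \<le> \<bar>u c\<bar> * (M * \<bar>v y\<bar> + norm (grad v y))"
      by (rule mult_left_mono) simp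
    also have "\<dots> = M * \<bar>u c * v y\<bar> + \<bar>u c\<bar> * norm (grad v y)"
      by (simp add: abs_mult algebra_simps)
    also have "\<bar>u c * v y\<bar> = ?a"
    proof -
      have "u c * v y = u c + (a * u c) * u (c + r *\<^sub>R y)" by (simp add: v_def algebra_simps)
      then show ?thesis by (simp add: a)
    qed
    also have "\<bar>u c\<bar> * norm (grad v y) = ?b"
    proof -
      have "\<bar>u c\<bar> * norm (grad v y) = \<bar>a * u c\<bar> * ?b"
        using assms by (simp add: gv abs_mult)
      then show ?thesis by (simp add: a)
    qed
    also have "M * ?a + ?b \<le> M * (?a + ?b)"
      using mult_right_mono[of 1 M ?b] M(1) \<open>0 < r\<close> by (simp add: distrib_left)
    finally have "(\<bar>u c\<bar> * norm (grad w y)) powr p \<le> (M * (?a + ?b)) powr p"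
      using assms by (intro powr_mono2) auto
    also have "\<dots> = M powr p * (?a + ?b) powr p"
      using M assms by (simp add: powr_mult)
    also have "\<dots> \<le> M powr p * (2 powr p * (?a powr p + ?b powr p))"
      using assms by (intro mult_left_mono powr_sum_le) auto
    also have "\<dots> = (2 * M) powr p * (?a powr p + r powr p * norm (grad u (c + r *\<^sub>R y)) powr p)"
      using M assms by (simp add: powr_mult)
    finally show ?thesis by (simp add: powr_mult)
  qed
  have [measurable]: "grad w \<in> borel_measurable borel"
    by (rule smooth_grad_measurable[OF sw])
  have "ennreal (\<bar>u c\<bar> powr p) * (ennreal \<gamma> * unit_capacity p (cball 0 1 :: (real^'n) set)) \<le>
     ennreal (\<bar>u c\<bar> powr p) * energy p w"
    by (intro mult_left_mono 1) simp
  also have "\<dots> = (\<integral>\<^sup>+y. ennreal (\<bar>u c\<bar> powr p * norm (grad w y) powr p) \<partial>lborel)"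
    unfolding energy_def by (simp add: nn_integral_cmult[symmetric] ennreal_mult)
  also have "\<dots> \<le> (\<integral>\<^sup>+y. ennreal ((2 * M) powr p) * ((ennreal (\<bar>u (c + r *\<^sub>R y) - u c\<bar> powr p) +
       ennreal (r powr p) * ennreal (norm (grad u (c + r *\<^sub>R y)) powr p)) * indicator (ball 0 2) y) \<partial>lborel)"
  proof (rule nn_integral_mono)
    fix y :: "real^'n"
    show "ennreal (\<bar>u c\<bar> powr p * norm (grad w y) powr p) \<le> ennreal ((2 * M) powr p) *
      ((ennreal (\<bar>u (c + r *\<^sub>R y) - u c\<bar> powr p) +
       ennreal (r powr p) * ennreal (norm (grad u (c + r *\<^sub>R y)) powr p)) * indicator (ball 0 2) y)"
    proof (cases "y \<in> ball 0 2")
      case True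
      then show ?thesis
        using ennreal_leI[OF 2[of y]] by (simp add: ennreal_mult)
    qed (simp add: gw0)
  qed
  also have "\<dots> = ennreal ((2 * M) powr p) * (\<integral>\<^sup>+y\<in>ball 0 2. (ennreal (\<bar>u (c + r *\<^sub>R y) - u c\<bar> powr p) +
       ennreal (r powr p) * ennreal (norm (grad u (c + r *\<^sub>R y)) powr p)) \<partial>lborel)"
  proof (rule nn_integral_cmult)
    have "(\<lambda>y. ennreal (\<bar>u (c + r *\<^sub>R y) - u c\<bar> powr p)) \<in> borel_measurable lborel"
        "(\<lambda>y. ennreal (norm (grad u (c + r *\<^sub>R y)) powr p)) \<in> borel_measurable lborel"
      by measurable
    moreover have "(\<lambda>y. indicator (ball 0 2 :: (real^'n) set) y :: ennreal) \<in> borel_measurable lborel"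
      by (rule borel_measurable_indicator) simp
    ultimately show "(\<lambda>y. (ennreal (\<bar>u (c + r *\<^sub>R y) - u c\<bar> powr p) +
       ennreal (r powr p) * ennreal (norm (grad u (c + r *\<^sub>R y)) powr p)) * indicator (ball 0 2) y)
       \<in> borel_measurable lborel"
      by (intro borel_measurable_times_ennreal borel_measurable_add borel_measurable_const)
  qed
  finally show ?thesis .
qed simp

lemma poincare_non_negligible:
  assumes "1 < p" "0 < \<gamma>"
  shows "\<exists>K>0. \<forall>(\<Omega>::(real^'n) set) r u. open \<Omega> \<longrightarrow> 0 < r \<longrightarrow> u \<in> test_fun \<Omega> \<longrightarrow>
    (\<forall>c. \<not> negligible_in p \<gamma> c r (cball c r - \<Omega>)) \<longrightarrow>
    ennreal (K * r powr (- p)) * (\<integral>\<^sup>+x. ennreal (\<bar>u x\<bar> powr p) \<partial>lborel) \<le> energy p u"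
proof -
  obtain k where k: "0 < k" "unit_capacity p (cball 0 1 :: (real^'n) set) = ennreal k"
    using unit_capacity_real[OF assms(1), where 'n = 'n] .
  obtain \<theta> :: "real^'n \<Rightarrow> real" where \<theta>: "\<theta> \<in> test_fun (ball 0 2)" "\<And>x. 0 \<le> \<theta> x" "\<And>x. \<theta> x \<le> 1"
      "\<And>x. x \<in> cball 0 1 \<Longrightarrow> \<theta> x = 1"
    using ex_cutoff[of 1 2, where 'n = 'n] by auto
  obtain M0 where M0: "0 < M0" "\<And>x. norm (grad \<theta> x) \<le> M0"
    using test_fun_grad_bounded[OF \<theta>(1)] by metis
  \<comment> \<open>Raised above 1 so that the gradient term, which has coefficient 1, fits under
    the common factor \<open>M\<close>.\<close>
  define M where "M = M0 + 1"
  have M: "1 \<le> M" "norm (grad \<theta> x) \<le> M" for x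
    using M0(1) M0(2)[of x] by (simp_all add: M_def)
  define b where "b = measure lborel (ball 0 2 :: (real^'n) set)"
  have b: "emeasure lborel (ball 0 2 :: (real^'n) set) = ennreal b" "0 < b"
    by (simp_all add: b_def emeasure_ball measure_def content_ball)
  \<comment> \<open>For |y| < 2 the displacement r y costs (4 r)^p in the translation estimate, the
    gradient term adds r^p, and \<open>b\<close> comes from integrating over y.\<close>
  define C where "C = (2 * M) powr p * ((4 powr p + 1) * b)"
  have C: "0 < C" using M b by (simp add: C_def add_pos_pos)
  show ?thesis
  proof (intro exI[of _ "\<gamma> * k / C"] conjI allI impI)
    show "0 < \<gamma> * k / C" using assms k C by simp
    fix \<Omega> :: "(real^'n) set" and r u
    assume *: "open \<Omega>" "0 < r" "u \<in> test_fun \<Omega>" "\<forall>c. \<not> negligible_in p \<gamma> c r (cball c r - \<Omega>)"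
    have su: "smooth u" by (rule test_fun_smooth[OF *(3)])
    have [measurable]: "grad u \<in> borel_measurable borel" "u \<in> borel_measurable borel"
      using smooth_grad_measurable[OF su] smooth_measurable[OF su] by auto
    let ?f = "\<lambda>c y. (ennreal (\<bar>u (c + r *\<^sub>R y) - u c\<bar> powr p) +
       ennreal (r powr p) * ennreal (norm (grad u (c + r *\<^sub>R y)) powr p)) * indicator (ball 0 2) y"
    have inner: "(\<integral>\<^sup>+c. ?f c y \<partial>lborel) \<le>
       ennreal ((4 powr p + 1) * r powr p) * energy p u * indicator (ball 0 2) y" for y
    proof (cases "y \<in> ball 0 2")
      case True
      have m: "(\<lambda>x. ennreal (norm (grad u x) powr p)) \<in> borel_measurable borel" by measurable
      have "(\<integral>\<^sup>+c. ?f c y \<partial>lborel) = (\<integral>\<^sup>+c. ennreal (\<bar>u (c + r *\<^sub>R y) - u c\<bar> powr p) \<partial>lborel) +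
          ennreal (r powr p) * (\<integral>\<^sup>+c. ennreal (norm (grad u (c + r *\<^sub>R y)) powr p) \<partial>lborel)"
        using True by (simp add: nn_integral_add nn_integral_cmult)
      also have "(\<integral>\<^sup>+c. ennreal (norm (grad u (c + r *\<^sub>R y)) powr p) \<partial>lborel) = energy p u"
        using nn_integral_shift[OF m, of "r *\<^sub>R y"] by (simp add: energy_def add.commute)
      also have "(\<integral>\<^sup>+c. ennreal (\<bar>u (c + r *\<^sub>R y) - u c\<bar> powr p) \<partial>lborel) + ennreal (r powr p) * energy p u
          \<le> ennreal ((4 * r) powr p) * energy p u + ennreal (r powr p) * energy p u"
      proof (rule add_right_mono)
        have "(\<integral>\<^sup>+c. ennreal (\<bar>u (c + r *\<^sub>R y) - u c\<bar> powr p) \<partial>lborel)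
            \<le> ennreal ((2 * norm (r *\<^sub>R y)) powr p) * energy p u"
          using assms by (intro translation_estimate su) simp
        also have "\<dots> \<le> ennreal ((4 * r) powr p) * energy p u"
          using True assms *(2) by (intro mult_right_mono ennreal_leI powr_mono2) auto
        finally show "(\<integral>\<^sup>+c. ennreal (\<bar>u (c + r *\<^sub>R y) - u c\<bar> powr p) \<partial>lborel)
            \<le> ennreal ((4 * r) powr p) * energy p u" .
      qed
      also have "\<dots> = ennreal ((4 powr p + 1) * r powr p) * energy p u"
        using *(2) by (simp add: powr_mult ennreal_plus distrib_right ennreal_mult)
      finally show ?thesis
        using True by simp
    qed simp
    have [measurable]: "(\<lambda>y. indicator (ball 0 2 :: (real^'n) set) y :: ennreal) \<in> borel_measurable borel"
      by (rule borel_measurable_indicator) simp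
    have "(\<lambda>z. ennreal (\<bar>u (fst z + r *\<^sub>R snd z) - u (fst z)\<bar> powr p)) \<in> borel_measurable (borel \<Otimes>\<^sub>M borel)"
        "(\<lambda>z. ennreal (norm (grad u (fst z + r *\<^sub>R snd z)) powr p)) \<in> borel_measurable (borel \<Otimes>\<^sub>M borel)"
      by measurable
    moreover have "(\<lambda>z. indicator (ball 0 2 :: (real^'n) set) (snd z) :: ennreal) \<in> borel_measurable (borel \<Otimes>\<^sub>M borel)"
      by (rule measurable_compose[OF measurable_snd borel_measurable_indicator]) simp
    ultimately have fm': "(\<lambda>z. ?f (fst z) (snd z)) \<in> borel_measurable (borel \<Otimes>\<^sub>M borel)"
      by (intro borel_measurable_times_ennreal borel_measurable_add borel_measurable_const)
    have fm: "(\<lambda>(c, y). ?f c y) \<in> borel_measurable (lborel \<Otimes>\<^sub>M lborel)"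
    proof -
      have eq: "borel_measurable (lborel \<Otimes>\<^sub>M lborel) = borel_measurable ((borel :: (real^'n) measure) \<Otimes>\<^sub>M (borel :: (real^'n) measure))"
        by (intro measurable_cong_sets sets_pair_measure_cong) simp_all
      show ?thesis
        unfolding case_prod_beta eq by (rule fm')
    qed
    have "ennreal (\<gamma> * k) * (\<integral>\<^sup>+x. ennreal (\<bar>u x\<bar> powr p) \<partial>lborel) =
       (\<integral>\<^sup>+c. ennreal (\<bar>u c\<bar> powr p) * (ennreal \<gamma> * unit_capacity p (cball 0 1 :: (real^'n) set)) \<partial>lborel)"
    proof -
      have "ennreal (\<gamma> * k) * (\<integral>\<^sup>+x. ennreal (\<bar>u x\<bar> powr p) \<partial>lborel) =
          (\<integral>\<^sup>+x. ennreal (\<gamma> * k) * ennreal (\<bar>u x\<bar> powr p) \<partial>lborel)"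
        by (intro nn_integral_cmult[symmetric]) measurable
      then show ?thesis using k assms by (simp add: ennreal_mult ac_simps)
    qed
    also have "\<dots> \<le> (\<integral>\<^sup>+c. ennreal ((2 * M) powr p) * (\<integral>\<^sup>+y. ?f c y \<partial>lborel) \<partial>lborel)"
      using assms(2) * by (intro nn_integral_mono pointwise_lower_bound[OF assms(1) _ \<theta> M]) auto
    also have "\<dots> = ennreal ((2 * M) powr p) * (\<integral>\<^sup>+c. (\<integral>\<^sup>+y. ?f c y \<partial>lborel) \<partial>lborel)"
      using lborel.borel_measurable_nn_integral_fst[OF fm] by (intro nn_integral_cmult) simp
    also have "(\<integral>\<^sup>+c. (\<integral>\<^sup>+y. ?f c y \<partial>lborel) \<partial>lborel) = (\<integral>\<^sup>+y. (\<integral>\<^sup>+c. ?f c y \<partial>lborel) \<partial>lborel)"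
      by (rule lborel_pair.Fubini'[OF fm, symmetric])
    also have "\<dots> \<le> (\<integral>\<^sup>+y. ennreal ((4 powr p + 1) * r powr p) * energy p u * indicator (ball 0 2 :: (real^'n) set) y \<partial>lborel)"
      by (intro nn_integral_mono inner)
    also have "\<dots> = ennreal ((4 powr p + 1) * r powr p) * energy p u * ennreal b"
      using b by (simp add: nn_integral_cmult)
    also have "ennreal ((2 * M) powr p) * \<dots> = ennreal (C * r powr p) * energy p u"
      using b by (simp add: C_def ennreal_mult ac_simps)
    finally have "ennreal (\<gamma> * k / (C * r powr p)) * (\<integral>\<^sup>+x. ennreal (\<bar>u x\<bar> powr p) \<partial>lborel) \<le> energy p u"
      using C *(2) assms k by (intro ennreal_le_mult_cancel) (auto simp: mult_left_mono)
    then show "ennreal (\<gamma> * k / C * r powr (- p)) * (\<integral>\<^sup>+x. ennreal (\<bar>u x\<bar> powr p) \<partial>lborel) \<le> energy p u"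
      by (simp add: powr_minus divide_inverse ac_simps)
  qed
qed

section \<open>The upper bound\<close>

text \<open>The chain rule accounts for L^p and the expanding change of variables for
  m^(-n).\<close>

lemma energy_le_compose:
  fixes T :: "real^'n \<Rightarrow> real^'n"
  assumes "smooth h" "0 < p"
    and m: "0 < m" "\<And>x y. m * dist x y \<le> dist (T x) (T y)"
    and "surj T"
    and T': "\<And>x. (T has_derivative T' x) (at x)" "\<And>x v. norm (T' x v) \<le> L * norm v"
  shows "energy p (\<lambda>x. h (T x)) \<le> ennreal (L powr p * inverse m ^ CARD('n)) * energy p h"
proof -
  have [measurable]: "grad h \<in> borel_measurable borel"
    by (rule smooth_grad_measurable[OF assms(1)])
  have cont: "continuous_on UNIV T"
    using T'(1) by (meson continuous_on_eq_continuous_at has_derivative_continuous open_UNIV)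
  have [measurable]: "T \<in> borel_measurable borel"
    using cont by (rule borel_measurable_continuous_onI)
  have 1: "norm (grad (\<lambda>x. h (T x)) x) \<le> L * norm (grad h (T x))" for x
  proof -
    let ?g = "grad (\<lambda>x. h (T x)) x"
    have D: "((\<lambda>x. h (T x)) has_derivative (\<lambda>v. grad h (T x) \<bullet> T' x v)) (at x)"
      by (rule has_derivative_compose[OF T'(1) smooth_has_derivative[OF assms(1)]])
    have "(\<lambda>v. ?g \<bullet> v) = (\<lambda>v. grad h (T x) \<bullet> T' x v)"
      by (rule has_derivative_unique[OF frechet_derivative_grad[OF differentiableI[OF D]] D])
    \<comment> \<open>Testing the derivative in the direction of the gradient itself bounds its norm
      without an adjoint of \<open>T' x\<close>.\<close>
    then have "?g \<bullet> ?g = grad h (T x) \<bullet> T' x ?g" by meson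
    also have "\<dots> \<le> norm (grad h (T x)) * norm (T' x ?g)"
      by (rule norm_cauchy_schwarz)
    also have "\<dots> \<le> norm (grad h (T x)) * (L * norm ?g)"
      by (intro mult_left_mono T'(2)) simp
    finally have "norm ?g * norm ?g \<le> (L * norm (grad h (T x))) * norm ?g"
      by (simp add: dot_square_norm power2_eq_square ac_simps)
    moreover have "0 \<le> L * norm (grad h (T x))"
      using T'(2)[of x "grad h (T x)"] norm_ge_zero order_trans by blast
    ultimately show ?thesis
      by (cases "norm ?g = 0") (auto simp: mult_le_cancel_right)
  qed
  have L: "0 \<le> L"
    using T'(2)[of 0 "axis undefined 1"] norm_ge_zero[of "T' 0 (axis undefined 1)"]
    by (simp del: norm_ge_zero)
  let ?f = "\<lambda>x. ennreal (norm (grad h x) powr p)"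
  have "energy p (\<lambda>x. h (T x)) \<le> (\<integral>\<^sup>+x. ennreal (L powr p) * ?f (T x) \<partial>lborel)"
    unfolding energy_def
  proof (rule nn_integral_mono)
    fix x
    have "norm (grad (\<lambda>x. h (T x)) x) powr p \<le> (L * norm (grad h (T x))) powr p"
      using 1 assms(2) by (intro powr_mono2) auto
    also have "\<dots> = L powr p * norm (grad h (T x)) powr p"
      using L by (simp add: powr_mult)
    finally show "ennreal (norm (grad (\<lambda>x. h (T x)) x) powr p) \<le> ennreal (L powr p) * ?f (T x)"
      by (simp add: ennreal_leI flip: ennreal_mult)
  qed
  also have "\<dots> = ennreal (L powr p) * (\<integral>\<^sup>+x. ?f (T x) \<partial>lborel)"
    by (rule nn_integral_cmult) measurable
  also have "\<dots> \<le> ennreal (L powr p) * (ennreal (inverse m ^ CARD('n)) * energy p h)"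
    using nn_integral_expanding_le[OF m \<open>surj T\<close> cont, of ?f]
    by (intro mult_left_mono) (auto simp: energy_def)
  also have "\<dots> = ennreal (L powr p * inverse m ^ CARD('n)) * energy p h"
    using m by (simp add: ennreal_mult mult.assoc)
  finally show ?thesis .
qed

text \<open>A preimage of y is the fixed point of the contraction x \<mapsto> y + \<phi>(x).\<close>

lemma surj_identity_minus_contraction:
  fixes \<phi> :: "'a::euclidean_space \<Rightarrow> 'a"
  assumes "0 \<le> c" "c < 1" "\<And>x y. dist (\<phi> x) (\<phi> y) \<le> c * dist x y"
  shows "surj (\<lambda>x. x - \<phi> x)"
proof (rule surjI)
  fix y
  have "\<exists>!x. y + \<phi> x = x"
    using assms by (intro banach_fix_type[of c]) auto
  then have "y + \<phi> (THE x. y + \<phi> x = x) = (THE x. y + \<phi> x = x)"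
    by (rule theI')
  then show "(THE x. y + \<phi> x = x) - \<phi> (THE x. y + \<phi> x = x) = y"
    by (simp add: algebra_simps)
qed

text \<open>The map $x \mapsto x - s\,\theta(x)\,x$ is a diffeomorphism close to the identity which
  shrinks the unit ball and fixes everything outside the ball of radius $2$.\<close>

lemma unit_capacity_le_smaller_ball:
  assumes "0 < p" "0 < e"
  shows "\<exists>s. 0 < s \<and> s < 1 \<and> (\<forall>h \<in> test_fun (unit_domain p :: (real^'n) set).
     (\<forall>x\<in>cball 0 (1 - s). 1 \<le> h x) \<longrightarrow> unit_capacity p (cball 0 1 :: (real^'n) set) \<le> ennreal (1 + e) * energy p h)"
proof -
  obtain \<theta> :: "real^'n \<Rightarrow> real" where \<theta>: "\<theta> \<in> test_fun (ball 0 2)" "\<And>x. 0 \<le> \<theta> x" "\<And>x. \<theta> x \<le> 1"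
      "\<And>x. x \<in> cball 0 1 \<Longrightarrow> \<theta> x = 1"
    using ex_cutoff[of 1 2, where 'n = 'n] by auto
  have s\<theta>: "smooth \<theta>" by (rule test_fun_smooth[OF \<theta>(1)])
  obtain K\<theta> where K\<theta>: "compact K\<theta>" "K\<theta> \<subseteq> ball 0 2" "\<And>x. x \<notin> K\<theta> \<Longrightarrow> \<theta> x = 0" "\<And>x. x \<notin> K\<theta> \<Longrightarrow> grad \<theta> x = 0"
    using test_funE[OF \<theta>(1)] by metis
  obtain M where M: "0 < M" "\<And>x. norm (grad \<theta> x) \<le> M"
    using test_fun_grad_bounded[OF \<theta>(1)] by metis
  \<comment> \<open>The derivative of \<theta>(x) x has norm at most |\<theta>(x)| + |grad
    \<theta>(x)| |x|, and |x| < 2 wherever the second term is nonzero.\<close>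
  define L where "L = 2 * M + 1"
  have L: "0 < L" using M by (simp add: L_def)
  define \<phi> where "\<phi> = (\<lambda>x. \<theta> x *\<^sub>R x)"
  define \<phi>' where "\<phi>' = (\<lambda>x v. \<theta> x *\<^sub>R v + (grad \<theta> x \<bullet> v) *\<^sub>R x)"
  have D: "(\<phi> has_derivative \<phi>' x) (at x)" for x
    unfolding \<phi>_def \<phi>'_def by (rule has_derivative_scaleR[OF smooth_has_derivative[OF s\<theta>] has_derivative_ident])
  have B: "norm (\<phi>' x v) \<le> L * norm v" for x v
  proof -
    have "norm (grad \<theta> x) * norm x \<le> M * 2"
    proof (cases "x \<in> K\<theta>")
      case True
      then show ?thesis using M(2)[of x] K\<theta>(2) M(1) by (intro mult_mono) auto
    qed (use K\<theta>(4) M in simp)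
    then have "\<bar>grad \<theta> x \<bullet> v\<bar> * norm x \<le> M * 2 * norm v"
      using mult_right_mono[OF Cauchy_Schwarz_ineq2[of "grad \<theta> x" v], of "norm x"]
        mult_right_mono[of "norm (grad \<theta> x) * norm x" "M * 2" "norm v"]
      by (simp add: ac_simps)
    moreover have "\<bar>\<theta> x\<bar> * norm v \<le> 1 * norm v"
      using \<theta>(2,3)[of x] by (intro mult_right_mono) auto
    moreover have "norm (\<phi>' x v) \<le> \<bar>\<theta> x\<bar> * norm v + \<bar>grad \<theta> x \<bullet> v\<bar> * norm x"
      unfolding \<phi>'_def by (rule norm_triangle_le) simp
    ultimately show ?thesis by (simp add: L_def algebra_simps)
  qed
  have lip: "dist (\<phi> x) (\<phi> y) \<le> L * dist x y" for x y
    unfolding dist_norm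
    by (rule differentiable_bound[of UNIV \<phi> \<phi>']) (auto intro: D onorm_le B)
  \<comment> \<open>The distortion of energy under composition with the map tends to 1 as s tends to
    0, which makes a suitable \<open>s\<close> available.\<close>
  have "((\<lambda>s. (1 + s * L) powr p * inverse (1 - s * L) ^ CARD('n)) \<longlongrightarrow>
      (1 + 0 * L) powr p * inverse (1 - 0 * L) ^ CARD('n)) (at_right 0)"
    by (intro tendsto_intros) auto
  then have "eventually (\<lambda>s. (1 + s * L) powr p * inverse (1 - s * L) ^ CARD('n) < 1 + e) (at_right 0)"
    using assms(2) by (intro order_tendstoD) auto
  moreover have "eventually (\<lambda>s. s \<in> {0<..<min 1 (1 / L)}) (at_right 0)"
    using L by (intro eventually_at_right_real) auto
  ultimately have "eventually (\<lambda>s. (1 + s * L) powr p * inverse (1 - s * L) ^ CARD('n) < 1 + e \<and>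
      s \<in> {0<..<min 1 (1 / L)}) (at_right 0)"
    by (rule eventually_conj)
  then obtain s where s: "(1 + s * L) powr p * inverse (1 - s * L) ^ CARD('n) < 1 + e" "s \<in> {0<..<min 1 (1 / L)}"
    using eventually_happens'[OF trivial_limit_at_right_real] by blast
  then have s01: "0 < s" "s < 1" "s * L < 1"
    using L by (auto simp: field_simps)
  define T where "T = (\<lambda>x. x - s *\<^sub>R \<phi> x)"
  define T' where "T' = (\<lambda>x v. v - s *\<^sub>R \<phi>' x v)"
  have slip: "dist (s *\<^sub>R \<phi> x) (s *\<^sub>R \<phi> y) \<le> (s * L) * dist x y" for x y
    using mult_left_mono[OF lip[of x y], of s] s01
    by (simp add: mult.assoc dist_norm flip: scaleR_diff_right)
  have surj: "surj T"
    unfolding T_def using s01 L slip by (intro surj_identity_minus_contraction[of "s * L"]) auto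
  have DT: "(T has_derivative T' x) (at x)" for x
    unfolding T_def T'_def by (intro has_derivative_diff has_derivative_ident has_derivative_scaleR_right D)
  have BT: "norm (T' x v) \<le> (1 + s * L) * norm v" for x v
  proof -
    have "norm (T' x v) \<le> norm v + s * norm (\<phi>' x v)"
      unfolding T'_def using norm_triangle_ineq4[of v "s *\<^sub>R \<phi>' x v"] s01 by simp
    also have "\<dots> \<le> norm v + s * (L * norm v)"
      using B s01 by (intro add_left_mono mult_left_mono) auto
    finally show ?thesis by (simp add: algebra_simps)
  qed
  have mT: "(1 - s * L) * dist x y \<le> dist (T x) (T y)" for x y
  proof -
    have "dist x y \<le> dist (T x) (T y) + dist (s *\<^sub>R \<phi> x) (s *\<^sub>R \<phi> y)"
      unfolding dist_norm T_def
      using norm_triangle_ineq[of "(x - s *\<^sub>R \<phi> x) - (y - s *\<^sub>R \<phi> y)" "s *\<^sub>R \<phi> x - s *\<^sub>R \<phi> y"] by simp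
    with slip[of x y] show ?thesis by (simp add: algebra_simps)
  qed
  have sT: "smooth (\<lambda>x. T x $ j)" for j
  proof -
    have eq: "(\<lambda>x. T x $ j) = (\<lambda>x. x $ j - s * (\<theta> x * x $ j))"
      by (simp add: T_def \<phi>_def mult.assoc)
    show ?thesis
      unfolding eq by (rule smooth_diff[OF smooth_component smooth_mult[OF smooth_const smooth_mult[OF s\<theta> smooth_component]]])
  qed
  show ?thesis
  proof (intro exI[of _ s] conjI ballI impI s01(1,2))
    fix h :: "real^'n \<Rightarrow> real"
    assume h: "h \<in> test_fun (unit_domain p)" "\<forall>x\<in>cball 0 (1 - s). 1 \<le> h x"
    have sh: "smooth h" by (rule test_fun_smooth[OF h(1)])
    obtain K where K: "compact K" "K \<subseteq> unit_domain p" "\<And>x. x \<notin> K \<Longrightarrow> h x = 0"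
      using test_funE[OF h(1)] by metis
    have "unit_capacity p (cball 0 1 :: (real^'n) set) \<le> energy p (\<lambda>x. h (T x))"
      unfolding unit_capacity_def
    proof (rule p_capacity_in_le)
      show "(\<lambda>x. h (T x)) \<in> test_fun (unit_domain p)"
      proof (rule test_funI)
        show "smooth (\<lambda>x. h (T x))" by (rule smooth_compose[OF sh sT])
        show "compact (K \<union> K\<theta>)" using K K\<theta> by blast
        show "K \<union> K\<theta> \<subseteq> unit_domain p"
          using K(2) K\<theta>(2) ball_subset_unit_domain by blast
        show "h (T x) = 0" if "x \<notin> K \<union> K\<theta>" for x
          using that K(3) K\<theta>(3) by (simp add: T_def \<phi>_def)
      qed
      show "1 \<le> h (T x)" if "x \<in> cball 0 1" for x
      proof -
        have "T x = (1 - s) *\<^sub>R x"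
          using \<theta>(4)[OF that] by (simp add: T_def \<phi>_def algebra_simps)
        moreover have "(1 - s) * norm x \<le> (1 - s) * 1"
          using that s01 by (intro mult_left_mono) auto
        ultimately show ?thesis using h(2) s01 by simp
      qed
    qed
    also have "\<dots> \<le> ennreal ((1 + s * L) powr p * inverse (1 - s * L) ^ CARD('n)) * energy p h"
      using s01 by (intro energy_le_compose[OF sh assms(1) _ mT surj DT BT]) simp
    also have "\<dots> \<le> ennreal (1 + e) * energy p h"
      using s(1) by (intro mult_right_mono ennreal_leI) auto
    finally show "unit_capacity p (cball 0 1 :: (real^'n) set) \<le> ennreal (1 + e) * energy p h" .
  qed
qed

text \<open>Splitting at b = e a keeps the coefficient of a^p close to 1 and lets b^p carry the
  large constant. The cruder factor 2^p on a^p could push \<open>q\<close> above 1.\<close>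

lemma powr_sum_le_weighted:
  fixes a b p e :: real
  assumes "0 \<le> a" "0 \<le> b" "0 \<le> p" "0 < e"
  shows "(a + b) powr p \<le> (1 + e) powr p * a powr p + (1 + 1 / e) powr p * b powr p"
proof (cases "b \<le> e * a")
  case True
  have "(a + b) powr p \<le> ((1 + e) * a) powr p"
    using True assms by (intro powr_mono2) (auto simp: algebra_simps)
  also have "\<dots> = (1 + e) powr p * a powr p"
    using assms by (simp add: powr_mult)
  finally show ?thesis by (simp add: add_increasing2)
next
  case False
  then have "a \<le> b / e" using assms by (simp add: field_simps)
  then have "(a + b) powr p \<le> ((1 + 1 / e) * b) powr p"
    using assms by (intro powr_mono2) (auto simp: algebra_simps)
  also have "\<dots> = (1 + 1 / e) powr p * b powr p"
    using assms by (simp add: powr_mult)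
  finally show ?thesis by (simp add: add_increasing)
qed

lemma grad_one_minus:
  assumes "smooth w"
  shows "grad (\<lambda>x. 1 - w x) x = - grad w x"
  by (rule grad_eqI) (use has_derivative_diff[OF has_derivative_const smooth_has_derivative[OF assms]] in simp)


text \<open>The argument is direct: the competitor built from \<open>w\<close> yields k \<le> q k +
  C I for the integral I in the conclusion. The energy hypothesis carries a factor (1 + e)^p in
  anticipation of the smooth truncation, and t < 1 leaves room for a cutoff inside the unit
  ball.\<close>

lemma integrated_deficit_lower_bound:
  assumes "1 < p" "0 < \<gamma>1" "\<gamma>1 < 1"
    and k: "0 < k" "unit_capacity p (cball 0 1 :: (real^'n) set) = ennreal k"
  shows "\<exists>e a t. 0 < e \<and> 0 < a \<and> 0 < t \<and> t < 1 \<and> (\<forall>w \<in> test_fun (unit_domain p :: (real^'n) set).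
     (\<forall>x. 0 \<le> w x \<and> w x \<le> 1) \<longrightarrow> energy p w \<le> ennreal ((1 + e) powr p * (\<gamma>1 * k)) \<longrightarrow>
     ennreal a \<le> (\<integral>\<^sup>+x\<in>ball 0 t. ennreal ((1 - w x) powr p) \<partial>lborel))"
proof -
  \<comment> \<open>The losses amount to (1 + e)^(2p + 1): a power p from truncation, a power p from
    gluing in the cutoff, one factor from shrinking the ball. At 1 + e = \<open>Q\<close> they would
    exactly use up 1/\<gamma>1, so 1 + e is taken halfway between 1 and \<open>Q\<close>.\<close>
  define Q where "Q = (1 / \<gamma>1) powr (1 / (2 * p + 1))"
  have "1 powr (1 / (2 * p + 1)) < Q"
    unfolding Q_def using assms by (intro powr_less_mono2) auto
  then have Q: "1 < Q" by simp
  define e where "e = (Q - 1) / 2"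
  have e: "0 < e" "1 + e < Q" using Q by (auto simp: e_def field_simps)
  define q where "q = (1 + e) * ((1 + e) powr p * ((1 + e) powr p * \<gamma>1))"
  have "(1 + e) powr (2 * p + 1) < Q powr (2 * p + 1)"
    using e assms by (intro powr_less_mono2) auto
  also have "\<dots> = 1 / \<gamma>1"
    using assms by (simp add: Q_def powr_powr)
  finally have "(1 + e) powr (2 * p + 1) * \<gamma>1 < 1"
    using assms by (simp add: field_simps)
  moreover have "(1 + e) powr (2 * p + 1) = (1 + e) * ((1 + e) powr p * (1 + e) powr p)"
  proof -
    have "(1 + e) powr (2 * p + 1) = (1 + e) powr (p + p + 1)" by (simp only: mult_2)
    also have "\<dots> = (1 + e) powr p * (1 + e) powr p * (1 + e) powr 1" by (simp only: powr_add)
    finally show ?thesis using e(1) by simp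
  qed
  ultimately have q: "q < 1" by (simp only: q_def ac_simps)
  obtain s where s: "0 < s" "s < 1" and cap: "\<And>h. h \<in> test_fun (unit_domain p :: (real^'n) set) \<Longrightarrow>
     (\<forall>x\<in>cball 0 (1 - s). 1 \<le> h x) \<Longrightarrow> unit_capacity p (cball 0 1 :: (real^'n) set) \<le> ennreal (1 + e) * energy p h"
    using unit_capacity_le_smaller_ball[of p e, where 'n = 'n] assms e by auto
  define t where "t = 1 - s / 2"
  have t: "1 - s < t" "0 < t" "t < 1" using s by (auto simp: t_def)
  obtain \<zeta> :: "real^'n \<Rightarrow> real" where \<zeta>: "\<zeta> \<in> test_fun (ball 0 t)" "\<And>x. 0 \<le> \<zeta> x" "\<And>x. \<zeta> x \<le> 1"
      "\<And>x. x \<in> cball 0 (1 - s) \<Longrightarrow> \<zeta> x = 1"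
    using ex_cutoff[of "1 - s" t, where 'n = 'n] s t by auto
  have s\<zeta>: "smooth \<zeta>" by (rule test_fun_smooth[OF \<zeta>(1)])
  obtain K\<zeta> where K\<zeta>: "compact K\<zeta>" "K\<zeta> \<subseteq> ball 0 t" "\<And>x. x \<notin> K\<zeta> \<Longrightarrow> \<zeta> x = 0" "\<And>x. x \<notin> K\<zeta> \<Longrightarrow> grad \<zeta> x = 0"
    using test_funE[OF \<zeta>(1)] by metis
  obtain M where M: "0 < M" "\<And>x. norm (grad \<zeta> x) \<le> M"
    using test_fun_grad_bounded[OF \<zeta>(1)] by metis
  define C where "C = (1 + e) * ((1 + 1 / e) powr p * M powr p)"
  have "0 < 1 + 1 / e" using e by (simp add: add_pos_pos)
  then have C: "0 < C" using e M by (simp add: C_def)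
  \<comment> \<open>The solution of k = q k + C a.\<close>
  define a where "a = (1 - q) * k / C"
  have a: "0 < a" using q k C by (simp add: a_def)
  show ?thesis
  proof (rule exI[of _ e], rule exI[of _ a], rule exI[of _ t], intro conjI ballI impI e(1) a t(2,3))
    fix w :: "real^'n \<Rightarrow> real"
    assume w: "w \<in> test_fun (unit_domain p)" "\<forall>x. 0 \<le> w x \<and> w x \<le> 1"
      "energy p w \<le> ennreal ((1 + e) powr p * (\<gamma>1 * k))"
    let ?I = "\<integral>\<^sup>+x\<in>ball 0 t. ennreal ((1 - w x) powr p) \<partial>lborel"
    have sw: "smooth w" by (rule test_fun_smooth[OF w(1)])
    have s1: "smooth (\<lambda>x. 1 - w x)" by (rule smooth_diff[OF smooth_const sw])
    have [measurable]: "w \<in> borel_measurable borel" "grad w \<in> borel_measurable borel"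
      by (rule smooth_measurable[OF sw], rule smooth_grad_measurable[OF sw])
    have Bm[measurable]: "ball 0 t \<in> sets (borel :: (real^'n) measure)" by simp
    \<comment> \<open>The convex combination of \<open>w\<close> and 1 with weight \<zeta>: it
      equals 1 on the smaller ball and coincides with \<open>w\<close> off the support of
      \<zeta>.\<close>
    define h where "h = (\<lambda>x. w x + \<zeta> x * (1 - w x))"
    have sh: "smooth h"
      unfolding h_def by (rule smooth_add[OF sw smooth_mult[OF s\<zeta> s1]])
    obtain K where K: "compact K" "K \<subseteq> unit_domain p" "\<And>x. x \<notin> K \<Longrightarrow> w x = 0"
      using test_funE[OF w(1)] by metis
    have "h \<in> test_fun (unit_domain p)"
    proof (rule test_funI[OF sh])
      show "compact (K \<union> K\<zeta>)" using K K\<zeta> by blast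
      have "ball 0 t \<subseteq> (ball 0 2 :: (real^'n) set)" using t by (intro subset_ball) simp
      then show "K \<union> K\<zeta> \<subseteq> unit_domain p"
        using K(2) K\<zeta>(2) ball_subset_unit_domain by blast
      show "h x = 0" if "x \<notin> K \<union> K\<zeta>" for x
        using that K(3) K\<zeta>(3) by (simp add: h_def)
    qed
    moreover have "\<forall>x\<in>cball 0 (1 - s). 1 \<le> h x"
      using \<zeta>(4) by (simp add: h_def)
    ultimately have kh: "ennreal k \<le> ennreal (1 + e) * energy p h"
      using cap k(2) by simp
    have "energy p h \<le> (\<integral>\<^sup>+x. ennreal ((1 + e) powr p) * ennreal (norm (grad w x) powr p) +
        ennreal ((1 + 1 / e) powr p * M powr p) * (ennreal ((1 - w x) powr p) * indicator (ball 0 t) x) \<partial>lborel)"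
      unfolding energy_def
    proof (rule nn_integral_mono)
      fix x :: "real^'n"
      \<comment> \<open>Bounds the cutoff part of the gradient. Off \<open>ball 0 t\<close> the
        gradient of \<zeta> is 0, so only the deficit over that ball enters.\<close>
      define b where "b = (if x \<in> ball 0 t then M * (1 - w x) else 0)"
      have b: "0 \<le> b" using w(2) M by (simp add: b_def)
      have "grad h x = grad w x + (\<zeta> x *\<^sub>R (- grad w x) + (1 - w x) *\<^sub>R grad \<zeta> x)"
        unfolding h_def
        by (subst grad_add[OF smooth_differentiable[OF sw] smooth_differentiable[OF smooth_mult[OF s\<zeta> s1]]],
            subst grad_mult[OF smooth_differentiable[OF s\<zeta>] smooth_differentiable[OF s1]],
            subst grad_one_minus[OF sw]) (rule refl)
      then have "grad h x = (1 - \<zeta> x) *\<^sub>R grad w x + (1 - w x) *\<^sub>R grad \<zeta> x"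
        by (simp add: algebra_simps)
      then have "norm (grad h x) \<le> \<bar>1 - \<zeta> x\<bar> * norm (grad w x) + \<bar>1 - w x\<bar> * norm (grad \<zeta> x)"
        by (simp add: norm_triangle_le)
      also have "\<dots> \<le> 1 * norm (grad w x) + b"
      proof (intro add_mono mult_right_mono)
        show "\<bar>1 - w x\<bar> * norm (grad \<zeta> x) \<le> b"
        proof (cases "x \<in> ball 0 t")
          case True
          then show ?thesis
            using w(2) M(2)[of x] mult_left_mono[of "norm (grad \<zeta> x)" M "1 - w x"]
            by (simp add: b_def mult.commute)
        next
          case False
          then have "grad \<zeta> x = 0" using K\<zeta>(2,4) by blast
          then show ?thesis using b by simp
        qed
      qed (use \<zeta>(2,3)[of x] in auto)
      finally have "norm (grad h x) powr p \<le> (norm (grad w x) + b) powr p"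
        using assms by (intro powr_mono2) auto
      also have "\<dots> \<le> (1 + e) powr p * norm (grad w x) powr p + (1 + 1 / e) powr p * b powr p"
        using b e assms by (intro powr_sum_le_weighted) auto
      finally have *: "ennreal (norm (grad h x) powr p) \<le>
          ennreal ((1 + e) powr p * norm (grad w x) powr p + (1 + 1 / e) powr p * b powr p)"
        by (rule ennreal_leI)
      have bp: "b powr p = (if x \<in> ball 0 t then M powr p * (1 - w x) powr p else 0)"
        using w(2) M assms by (simp add: b_def powr_mult)
      show "ennreal (norm (grad h x) powr p) \<le> ennreal ((1 + e) powr p) * ennreal (norm (grad w x) powr p) +
        ennreal ((1 + 1 / e) powr p * M powr p) * (ennreal ((1 - w x) powr p) * indicator (ball 0 t) x)"
        using * unfolding bp by (cases "x \<in> ball 0 t") (simp_all add: ennreal_mult mult.assoc)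
    qed
    also have "\<dots> = ennreal ((1 + e) powr p) * energy p w + ennreal ((1 + 1 / e) powr p * M powr p) * ?I"
    proof -
      have [measurable]: "(\<lambda>x. ennreal ((1 - w x) powr p) * indicator (ball 0 t) x) \<in> borel_measurable lborel"
        using Bm by (intro borel_measurable_times_ennreal borel_measurable_indicator) auto
      have [measurable]: "(\<lambda>x. ennreal (norm (grad w x) powr p)) \<in> borel_measurable lborel"
        by measurable
      show ?thesis
        unfolding energy_def by (simp add: nn_integral_add nn_integral_cmult)
    qed
    also have "\<dots> \<le> ennreal ((1 + e) powr p) * ennreal ((1 + e) powr p * (\<gamma>1 * k)) +
        ennreal ((1 + 1 / e) powr p * M powr p) * ?I"
      by (intro mult_left_mono add_right_mono w(3)) auto
    finally have "ennreal (1 + e) * energy p h \<le> ennreal (1 + e) *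
       (ennreal ((1 + e) powr p) * ennreal ((1 + e) powr p * (\<gamma>1 * k)) + ennreal ((1 + 1 / e) powr p * M powr p) * ?I)"
      by (rule mult_left_mono) simp
    also have "\<dots> = ennreal (1 + e) * (ennreal ((1 + e) powr p) * ennreal ((1 + e) powr p * (\<gamma>1 * k))) +
        ennreal (1 + e) * ennreal ((1 + 1 / e) powr p * M powr p) * ?I"
      by (simp only: distrib_left mult.assoc)
    also have "ennreal (1 + e) * (ennreal ((1 + e) powr p) * ennreal ((1 + e) powr p * (\<gamma>1 * k))) = ennreal (q * k)"
      using e assms k by (simp add: q_def mult.assoc del: ennreal_plus flip: ennreal_mult)
    also have "ennreal (1 + e) * ennreal ((1 + 1 / e) powr p * M powr p) = ennreal C"
      using e by (simp add: C_def del: ennreal_plus flip: ennreal_mult)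
    finally have "ennreal k \<le> ennreal (q * k) + ennreal C * ?I"
      using kh by (rule order_trans[rotated])
    then show "ennreal a \<le> ?I"
    proof (cases ?I)
      case (real r)
      have qk: "0 \<le> q * k" using e assms k by (simp add: q_def)
      assume "ennreal k \<le> ennreal (q * k) + ennreal C * ?I"
      also have "\<dots> = ennreal (q * k + C * r)"
        using real qk C by (simp add: ennreal_mult ennreal_plus)
      finally have "k \<le> q * k + C * r"
        using real qk C by (subst (asm) ennreal_le_iff) auto
      then have "a \<le> r"
        using C by (simp add: a_def field_simps)
      then show ?thesis using real by (simp add: ennreal_leI)
    qed simp
  qed
qed

lemma ex_test_fun_bounded_quotient:
  assumes "1 < p" "0 < \<gamma>" "\<gamma> < 1"
  shows "\<exists>K>0. \<forall>\<Omega> :: (real^'n) set. open \<Omega> \<longrightarrow>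
    unit_capacity p (cball 0 1 - \<Omega>) \<le> ennreal \<gamma> * unit_capacity p (cball 0 1 :: (real^'n) set) \<longrightarrow>
    (\<exists>f \<in> test_fun \<Omega>. 0 < (\<integral>\<^sup>+x. ennreal (\<bar>f x\<bar> powr p) \<partial>lborel) \<and>
       energy p f \<le> ennreal K * (\<integral>\<^sup>+x. ennreal (\<bar>f x\<bar> powr p) \<partial>lborel))"
proof -
  obtain k where k: "0 < k" "unit_capacity p (cball 0 1 :: (real^'n) set) = ennreal k"
    using unit_capacity_real[OF assms(1), where 'n = 'n] .
  \<comment> \<open>Strictly above \<gamma>, because the infimum need not be attained: some
    competitor still has energy below \<open>\<gamma>1 * k\<close>.\<close>
  define \<gamma>1 where "\<gamma>1 = (1 + \<gamma>) / 2"
  have \<gamma>1: "0 < \<gamma>1" "\<gamma>1 < 1" "\<gamma> < \<gamma>1" using assms by (auto simp: \<gamma>1_def)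
  obtain e a t where e: "0 < e" and a: "0 < a" and t: "0 < t" "t < 1" and deficit:
    "\<forall>w \<in> test_fun (unit_domain p :: (real^'n) set). (\<forall>x. 0 \<le> w x \<and> w x \<le> 1) \<longrightarrow>
     energy p w \<le> ennreal ((1 + e) powr p * (\<gamma>1 * k)) \<longrightarrow>
     ennreal a \<le> (\<integral>\<^sup>+x\<in>ball 0 t. ennreal ((1 - w x) powr p) \<partial>lborel)"
    using integrated_deficit_lower_bound[OF assms(1) \<gamma>1(1,2) k] by (elim exE conjE) (rule that)
  obtain \<psi> \<psi>' d where d: "0 < d" and \<psi>: "\<And>k. Ck1 k \<psi>" "\<And>t. t \<le> 0 \<Longrightarrow> \<psi> t = 0"
      "\<And>t. 1 - d \<le> t \<Longrightarrow> \<psi> t = 1" "\<And>t. 0 \<le> \<psi> t \<and> \<psi> t \<le> 1"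
      "\<And>t. (\<psi> has_real_derivative \<psi>' t) (at t)" "\<And>t. \<bar>\<psi>' t\<bar> \<le> 1 + e"
    using ex_truncation[OF e] by (elim exE conjE) (rule that; blast)
  obtain \<zeta> :: "real^'n \<Rightarrow> real" where \<zeta>: "\<zeta> \<in> test_fun (ball 0 1)" "\<And>x. 0 \<le> \<zeta> x" "\<And>x. \<zeta> x \<le> 1"
      "\<And>x. x \<in> cball 0 t \<Longrightarrow> \<zeta> x = 1"
    using ex_cutoff[of t 1, where 'n = 'n] t by auto
  have s\<zeta>: "smooth \<zeta>" by (rule test_fun_smooth[OF \<zeta>(1)])
  obtain K\<zeta> where K\<zeta>: "compact K\<zeta>" "K\<zeta> \<subseteq> ball 0 1" "\<And>x. x \<notin> K\<zeta> \<Longrightarrow> \<zeta> x = 0" "\<And>x. x \<notin> K\<zeta> \<Longrightarrow> grad \<zeta> x = 0"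
    using test_funE[OF \<zeta>(1)] by metis
  obtain M where M: "0 < M" "\<And>x. norm (grad \<zeta> x) \<le> M"
    using test_fun_grad_bounded[OF \<zeta>(1)] by metis
  define b where "b = measure lborel (ball 0 1 :: (real^'n) set)"
  have b: "emeasure lborel (ball 0 1 :: (real^'n) set) = ennreal b" "0 < b"
    by (simp_all add: b_def emeasure_ball measure_def content_ball)
  define E where "E = (1 + e) powr p * (\<gamma>1 * k)"
  have E: "0 < E" using e \<gamma>1 k by (simp add: E_def)
  \<comment> \<open>Bounds the energy of \<zeta> (1 - w): 2^p from splitting the gradient of the
    product, \<open>M powr p * b\<close> from the gradient of \<zeta> over the unit ball,
    \<open>E\<close> from that of \<open>w\<close>.\<close>
  define A where "A = 2 powr p * (M powr p * b + E)"
  have A: "0 < A" using M b E by (simp add: A_def add_pos_pos)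
  show ?thesis
  \<comment> \<open>\<open>A\<close> bounds the energy from above and \<open>a\<close> the integral
    of |f|^p from below.\<close>
  proof (intro exI[of _ "A / a"] conjI allI impI)
    show "0 < A / a" using A a by simp
    fix \<Omega> :: "(real^'n) set"
    assume "open \<Omega>" and neg: "unit_capacity p (cball 0 1 - \<Omega>) \<le> ennreal \<gamma> * unit_capacity p (cball 0 1 :: (real^'n) set)"
    have "ennreal \<gamma> * ennreal k < ennreal (\<gamma>1 * k)"
      using assms \<gamma>1 k by (simp add: ennreal_less_iff flip: ennreal_mult)
    then have "unit_capacity p (cball 0 1 - \<Omega>) < ennreal (\<gamma>1 * k)"
      using neg k(2) by simp
    then obtain g where g: "g \<in> test_fun (unit_domain p)" "\<And>x. x \<in> cball 0 1 - \<Omega> \<Longrightarrow> 1 \<le> g x"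
        "energy p g < ennreal (\<gamma>1 * k)"
      unfolding unit_capacity_def p_capacity_in_energy INF_less_iff by auto
    have sg: "smooth g" by (rule test_fun_smooth[OF g(1)])
    define w where "w = (\<lambda>x. \<psi> (g x))"
    have sw: "smooth w"
      unfolding w_def by (rule smooth_compose_real[OF \<psi>(1) sg])
    have s1: "smooth (\<lambda>x. 1 - w x)" by (rule smooth_diff[OF smooth_const sw])
    have w01: "\<forall>x. 0 \<le> w x \<and> w x \<le> 1" using \<psi>(4) by (simp add: w_def)
    obtain K where K: "compact K" "K \<subseteq> unit_domain p" "\<And>x. x \<notin> K \<Longrightarrow> g x = 0"
      using test_funE[OF g(1)] by metis
    have tw: "w \<in> test_fun (unit_domain p)"
      using K \<psi>(2) by (intro test_funI[OF sw K(1,2)]) (simp add: w_def)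
    have [measurable]: "grad g \<in> borel_measurable borel" "grad w \<in> borel_measurable borel"
      by (rule smooth_grad_measurable[OF sg], rule smooth_grad_measurable[OF sw])
    have "energy p w \<le> (\<integral>\<^sup>+x. ennreal ((1 + e) powr p) * ennreal (norm (grad g x) powr p) \<partial>lborel)"
      unfolding energy_def
    proof (rule nn_integral_mono)
      fix x
      have "norm (grad w x) \<le> (1 + e) * norm (grad g x)"
        unfolding w_def grad_compose_real(1)[OF \<psi>(5) smooth_differentiable[OF sg]]
        using \<psi>(6) by (simp add: mult_right_mono)
      then have "norm (grad w x) powr p \<le> ((1 + e) * norm (grad g x)) powr p"
        using assms by (intro powr_mono2) auto
      also have "\<dots> = (1 + e) powr p * norm (grad g x) powr p"
        using e by (simp add: powr_mult)
      finally show "ennreal (norm (grad w x) powr p) \<le> ennreal ((1 + e) powr p) * ennreal (norm (grad g x) powr p)"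
        by (simp add: ennreal_leI flip: ennreal_mult)
    qed
    also have "\<dots> = ennreal ((1 + e) powr p) * energy p g"
      unfolding energy_def by (rule nn_integral_cmult) measurable
    also have "\<dots> \<le> ennreal ((1 + e) powr p) * ennreal (\<gamma>1 * k)"
      using g(3) by (intro mult_left_mono) auto
    also have "\<dots> = ennreal E"
      using \<gamma>1 k by (simp add: E_def flip: ennreal_mult)
    finally have Ew: "energy p w \<le> ennreal E" .
    then have low: "ennreal a \<le> (\<integral>\<^sup>+x\<in>ball 0 t. ennreal ((1 - w x) powr p) \<partial>lborel)"
      unfolding E_def using deficit tw w01 by blast
    define f where "f = (\<lambda>x. \<zeta> x * (1 - w x))"
    have sf: "smooth f"
      unfolding f_def by (rule smooth_mult[OF s\<zeta> s1])
    have tf: "f \<in> test_fun \<Omega>"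
    proof (rule test_funI[OF sf])
      have "closed {x. g x \<le> 1 - d}"
        by (rule closed_Collect_le[OF smooth_continuous[OF sg] continuous_on_const])
      \<comment> \<open>Where g > 1 - d the truncation equals 1 and \<open>f\<close> vanishes. What
        is left is compact and avoids the part of the unit ball outside \<Omega>, where g \<ge>
        1.\<close>
      then show "compact (K\<zeta> \<inter> {x. g x \<le> 1 - d})"
        using K\<zeta>(1) by (rule compact_Int_closed[rotated])
      show "K\<zeta> \<inter> {x. g x \<le> 1 - d} \<subseteq> \<Omega>"
      proof
        fix x assume x: "x \<in> K\<zeta> \<inter> {x. g x \<le> 1 - d}"
        then have "x \<in> cball 0 1" using K\<zeta>(2) by fastforce
        with x g(2)[of x] d show "x \<in> \<Omega>" by fastforce
      qed
      show "f x = 0" if "x \<notin> K\<zeta> \<inter> {x. g x \<le> 1 - d}" for x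
        using that K\<zeta>(3)[of x] \<psi>(3)[of "g x"] by (auto simp: f_def w_def)
    qed
    have Ef: "energy p f \<le> ennreal A"
    proof -
      have "energy p f \<le> (\<integral>\<^sup>+x. ennreal (2 powr p * M powr p) * indicator (ball 0 1) x +
          ennreal (2 powr p) * ennreal (norm (grad w x) powr p) \<partial>lborel)"
        unfolding energy_def
      proof (rule nn_integral_mono)
        fix x :: "real^'n"
        show "ennreal (norm (grad f x) powr p) \<le> ennreal (2 powr p * M powr p) * indicator (ball 0 1) x +
          ennreal (2 powr p) * ennreal (norm (grad w x) powr p)"
        proof (cases "x \<in> ball 0 1")
          case True
          have "norm (grad f x) \<le> M * \<bar>1 - w x\<bar> + norm (grad (\<lambda>x. 1 - w x) x)"
            unfolding f_def using \<zeta>(2,3)[of x] by (intro norm_grad_scaled_mult_le s\<zeta> s1 M(2)) auto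
          also have "\<dots> \<le> M + norm (grad w x)"
            using M w01 by (simp add: grad_one_minus[OF sw] mult_left_le)
          finally have "norm (grad f x) powr p \<le> (M + norm (grad w x)) powr p"
            using assms by (intro powr_mono2) auto
          also have "\<dots> \<le> 2 powr p * (M powr p + norm (grad w x) powr p)"
            using M assms by (intro powr_sum_le) auto
          finally have "ennreal (norm (grad f x) powr p) \<le> ennreal (2 powr p * M powr p + 2 powr p * norm (grad w x) powr p)"
            by (intro ennreal_leI) (simp add: distrib_left)
          with True show ?thesis by (simp add: ennreal_mult)
        next
          case False
          then have "x \<notin> K\<zeta>" using K\<zeta>(2) by blast
          then have "grad f x = 0"
            unfolding f_def grad_mult[OF smooth_differentiable[OF s\<zeta>] smooth_differentiable[OF s1]]
            using K\<zeta>(3,4) by simp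
          then show ?thesis using assms by simp
        qed
      qed
      also have "\<dots> = ennreal (2 powr p * M powr p) * ennreal b + ennreal (2 powr p) * energy p w"
      proof -
        have i: "(\<lambda>x. indicator (ball 0 1 :: (real^'n) set) x :: ennreal) \<in> borel_measurable lborel"
          by (rule borel_measurable_indicator) simp
        have g: "(\<lambda>x. ennreal (norm (grad w x) powr p)) \<in> borel_measurable lborel"
          by measurable
        have "(\<integral>\<^sup>+x. indicator (ball 0 1 :: (real^'n) set) x \<partial>lborel) = ennreal b"
          unfolding b(1)[symmetric] by (rule nn_integral_indicator) simp
        then show ?thesis
          unfolding energy_def
          by (simp only: nn_integral_add[OF borel_measurable_times_ennreal[OF borel_measurable_const i]
                borel_measurable_times_ennreal[OF borel_measurable_const g]] nn_integral_cmult[OF i] nn_integral_cmult[OF g])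
      qed
      also have "\<dots> \<le> ennreal (2 powr p * M powr p) * ennreal b + ennreal (2 powr p) * ennreal E"
        by (intro add_left_mono mult_left_mono Ew) simp
      also have "\<dots> = ennreal A"
        using b E by (simp add: A_def distrib_left mult.assoc flip: ennreal_mult)
      finally show ?thesis .
    qed
    have "(\<integral>\<^sup>+x\<in>ball 0 t. ennreal ((1 - w x) powr p) \<partial>lborel) \<le> (\<integral>\<^sup>+x. ennreal (\<bar>f x\<bar> powr p) \<partial>lborel)"
    proof (rule nn_integral_mono)
      fix x :: "real^'n"
      show "ennreal ((1 - w x) powr p) * indicator (ball 0 t) x \<le> ennreal (\<bar>f x\<bar> powr p)"
        using \<zeta>(4)[of x] w01 by (cases "x \<in> ball 0 t") (auto simp: f_def)
    qed
    with low have af: "ennreal a \<le> (\<integral>\<^sup>+x. ennreal (\<bar>f x\<bar> powr p) \<partial>lborel)"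
      by (rule order_trans)
    show "\<exists>f \<in> test_fun \<Omega>. 0 < (\<integral>\<^sup>+x. ennreal (\<bar>f x\<bar> powr p) \<partial>lborel) \<and>
       energy p f \<le> ennreal (A / a) * (\<integral>\<^sup>+x. ennreal (\<bar>f x\<bar> powr p) \<partial>lborel)"
    proof (intro bexI[OF _ tf] conjI)
      show "0 < (\<integral>\<^sup>+x. ennreal (\<bar>f x\<bar> powr p) \<partial>lborel)"
        using af a by (metis ennreal_less_zero_iff less_le_trans)
      have "ennreal A = ennreal (A / a) * ennreal a"
        using A a by (simp flip: ennreal_mult)
      also have "\<dots> \<le> ennreal (A / a) * (\<integral>\<^sup>+x. ennreal (\<bar>f x\<bar> powr p) \<partial>lborel)"
        by (intro mult_left_mono af) simp
      finally show "energy p f \<le> ennreal (A / a) * (\<integral>\<^sup>+x. ennreal (\<bar>f x\<bar> powr p) \<partial>lborel)"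
        using Ef by (rule order_trans[rotated])
    qed
  qed
qed

section \<open>The two-sided estimate\<close>

lemma set_nn_integral_test_fun:
  fixes u :: "real^'n \<Rightarrow> real"
  assumes "u \<in> test_fun \<Omega>"
  shows "(\<integral>\<^sup>+x\<in>\<Omega>. ennreal (norm (grad u x) powr p) \<partial>lborel) = energy p u"
    and "(\<integral>\<^sup>+x\<in>\<Omega>. ennreal (\<bar>u x\<bar> powr p) \<partial>lborel) = (\<integral>\<^sup>+x. ennreal (\<bar>u x\<bar> powr p) \<partial>lborel)"
proof -
  obtain K where K: "K \<subseteq> \<Omega>" "\<And>x. x \<notin> K \<Longrightarrow> u x = 0" "\<And>x. x \<notin> K \<Longrightarrow> grad u x = 0"
    using test_funE[OF assms] by metis
  have z: "u x = 0" "grad u x = 0" if "x \<notin> \<Omega>" for x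
    using K that by blast+
  show "(\<integral>\<^sup>+x\<in>\<Omega>. ennreal (norm (grad u x) powr p) \<partial>lborel) = energy p u"
    unfolding energy_def
  proof (rule nn_integral_cong)
    show "ennreal (norm (grad u x) powr p) * indicator \<Omega> x = ennreal (norm (grad u x) powr p)" for x
      using z(2)[of x] by (cases "x \<in> \<Omega>") auto
  qed
  show "(\<integral>\<^sup>+x\<in>\<Omega>. ennreal (\<bar>u x\<bar> powr p) \<partial>lborel) = (\<integral>\<^sup>+x. ennreal (\<bar>u x\<bar> powr p) \<partial>lborel)"
  proof (rule nn_integral_cong)
    show "ennreal (\<bar>u x\<bar> powr p) * indicator \<Omega> x = ennreal (\<bar>u x\<bar> powr p)" for x
      using z(1)[of x] by (cases "x \<in> \<Omega>") auto
  qed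
qed

text \<open>By continuity \<open>u\<close> is nonzero on a whole ball, which has positive
  measure.\<close>

lemma nn_integral_powr_pos:
  fixes u :: "real^'n \<Rightarrow> real"
  assumes "smooth u" "u \<noteq> (\<lambda>_. 0)"
  shows "(\<integral>\<^sup>+x. ennreal (\<bar>u x\<bar> powr p) \<partial>lborel) \<noteq> 0"
proof
  assume "(\<integral>\<^sup>+x. ennreal (\<bar>u x\<bar> powr p) \<partial>lborel) = 0"
  moreover have [measurable]: "u \<in> borel_measurable borel"
    by (rule smooth_measurable[OF assms(1)])
  have m: "(\<lambda>x. ennreal (\<bar>u x\<bar> powr p)) \<in> borel_measurable lborel"
    by measurable
  ultimately have 0: "emeasure lborel {x \<in> space lborel. ennreal (\<bar>u x\<bar> powr p) \<noteq> 0} = 0"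
    using nn_integral_0_iff[OF m] by blast
  obtain x0 where x0: "u x0 \<noteq> 0" using assms(2) by auto
  have "open {x. u x \<noteq> 0}"
    by (rule open_Collect_neq[OF smooth_continuous[OF assms(1)] continuous_on_const])
  then obtain e where e: "0 < e" "ball x0 e \<subseteq> {x. u x \<noteq> 0}"
    using x0 open_contains_ball by blast
  have "emeasure lborel (ball x0 e) \<le> emeasure lborel {x \<in> space lborel. ennreal (\<bar>u x\<bar> powr p) \<noteq> 0}"
  proof (rule emeasure_mono)
    show "ball x0 e \<subseteq> {x \<in> space lborel. ennreal (\<bar>u x\<bar> powr p) \<noteq> 0}"
    proof
      fix x assume "x \<in> ball x0 e"
      then have "u x \<noteq> 0" using e(2) by blast
      then have "0 < \<bar>u x\<bar> powr p" by simp
      then show "x \<in> {x \<in> space lborel. ennreal (\<bar>u x\<bar> powr p) \<noteq> 0}"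
        by (simp add: ennreal_eq_0_iff)
    qed
    show "{x \<in> space lborel. ennreal (\<bar>u x\<bar> powr p) \<noteq> 0} \<in> sets lborel"
      using m by measurable
  qed
  then have "ennreal (unit_ball_vol (real CARD('n)) * e ^ CARD('n)) = 0"
    using 0 e(1) emeasure_ball[of e x0] by simp
  moreover have "0 < unit_ball_vol (real CARD('n)) * e ^ CARD('n)"
    by (intro mult_pos_pos unit_ball_vol_pos zero_less_power e(1)) simp
  ultimately show False
    by (metis ennreal_eq_0_iff not_le)
qed

lemma lambda1_ge:
  fixes \<Omega> :: "(real^'n) set"
  assumes "0 < p" "0 < l"
    and "\<And>u. u \<in> test_fun \<Omega> \<Longrightarrow> ennreal l * (\<integral>\<^sup>+x. ennreal (\<bar>u x\<bar> powr p) \<partial>lborel) \<le> energy p u"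
  shows "ennreal l \<le> lambda1 p \<Omega>"
  unfolding lambda1_def
proof (rule INF_greatest)
  fix u :: "real^'n \<Rightarrow> real" assume "u \<in> {u \<in> test_fun \<Omega>. u \<noteq> (\<lambda>_. 0)}"
  then have u: "u \<in> test_fun \<Omega>" "u \<noteq> (\<lambda>_. 0)" by auto
  let ?I = "\<integral>\<^sup>+x. ennreal (\<bar>u x\<bar> powr p) \<partial>lborel"
  have "?I \<noteq> 0"
    by (rule nn_integral_powr_pos[OF test_fun_smooth[OF u(1)] u(2)])
  \<comment> \<open>Cancellation in \<open>ennreal\<close> needs a finite factor. Finiteness follows
    from the assumed inequality, as the energy of a test function is finite.\<close>
  moreover have "?I \<noteq> top"
  proof
    assume "?I = top"
    then have "top \<le> energy p u"
      using assms(2) assms(3)[OF u(1)] by (simp add: ennreal_mult_top)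
    then show False using energy_finite[OF u(1) assms(1)] by simp
  qed
  ultimately have "ennreal l = ennreal l * ?I / ?I"
    by (simp add: mult_divide_eq_ennreal)
  also have "\<dots> \<le> energy p u / ?I"
    by (intro divide_right_mono_ennreal assms(3) u(1))
  finally show "ennreal l \<le> (\<integral>\<^sup>+x\<in>\<Omega>. ennreal (norm (grad u x) powr p) \<partial>lborel) /
     (\<integral>\<^sup>+x\<in>\<Omega>. ennreal (\<bar>u x\<bar> powr p) \<partial>lborel)"
    by (simp only: set_nn_integral_test_fun[OF u(1)])
qed

lemma lambda1_le:
  fixes \<Omega> :: "(real^'n) set"
  assumes "f \<in> test_fun \<Omega>" "0 < (\<integral>\<^sup>+x. ennreal (\<bar>f x\<bar> powr p) \<partial>lborel)"
    and "energy p f \<le> ennreal l * (\<integral>\<^sup>+x. ennreal (\<bar>f x\<bar> powr p) \<partial>lborel)"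
  shows "lambda1 p \<Omega> \<le> ennreal l"
proof -
  have "f \<noteq> (\<lambda>_. 0)"
    using assms(2) by auto
  then have "lambda1 p \<Omega> \<le> energy p f / (\<integral>\<^sup>+x. ennreal (\<bar>f x\<bar> powr p) \<partial>lborel)"
    unfolding lambda1_def set_nn_integral_test_fun[OF assms(1), symmetric]
    using assms(1) by (intro INF_lower) simp
  also have "\<dots> \<le> ennreal l"
    using assms(2,3) by (intro divide_le_posI_ennreal) (simp_all add: mult.commute)
  finally show ?thesis .
qed

text \<open>Transporting the test function from the unit ball to radius r multiplies the energy by
  r^(n-p) and the integral of |f|^p by r^n, hence the quotient by r^(-p).\<close>

lemma lambda1_le_negligible:
  assumes "1 < p" "0 < \<gamma>" "\<gamma> < 1"
  shows "\<exists>K>0. \<forall>(\<Omega> :: (real^'n) set) r c. open \<Omega> \<longrightarrow> 0 < r \<longrightarrow> negligible_in p \<gamma> c r (cball c r - \<Omega>) \<longrightarrow>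
     lambda1 p \<Omega> \<le> ennreal (K * r powr (- p))"
proof -
  obtain K where K: "0 < K" "\<And>\<Omega> :: (real^'n) set. open \<Omega> \<Longrightarrow>
    unit_capacity p (cball 0 1 - \<Omega>) \<le> ennreal \<gamma> * unit_capacity p (cball 0 1 :: (real^'n) set) \<Longrightarrow>
    \<exists>f \<in> test_fun \<Omega>. 0 < (\<integral>\<^sup>+x. ennreal (\<bar>f x\<bar> powr p) \<partial>lborel) \<and>
       energy p f \<le> ennreal K * (\<integral>\<^sup>+x. ennreal (\<bar>f x\<bar> powr p) \<partial>lborel)"
    using ex_test_fun_bounded_quotient[OF assms, where 'n = 'n] by blast
  show ?thesis
  proof (intro exI[of _ K] conjI allI impI K(1))
    fix \<Omega> :: "(real^'n) set" and r c
    assume \<Omega>: "open \<Omega>" and r: "0 < r" and neg: "negligible_in p \<gamma> c r (cball c r - \<Omega>)"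
    let ?\<Omega>' = "{x. c + r *\<^sub>R x \<in> \<Omega>}"
    have "open ?\<Omega>'"
      using continuous_open_vimage[OF \<Omega>, of "\<lambda>x. c + r *\<^sub>R x"]
      by (simp add: vimage_def continuous_intros)
    then obtain f where f: "f \<in> test_fun ?\<Omega>'" "0 < (\<integral>\<^sup>+x. ennreal (\<bar>f x\<bar> powr p) \<partial>lborel)"
       "energy p f \<le> ennreal K * (\<integral>\<^sup>+x. ennreal (\<bar>f x\<bar> powr p) \<partial>lborel)"
      using K(2) neg negligible_in_iff[OF r \<Omega>] assms(2) by (metis less_imp_le)
    let ?I = "\<integral>\<^sup>+x. ennreal (\<bar>f x\<bar> powr p) \<partial>lborel"
    have sf: "smooth f" by (rule test_fun_smooth[OF f(1)])
    have [measurable]: "f \<in> borel_measurable borel" by (rule smooth_measurable[OF sf])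
    have m: "(\<lambda>x. ennreal (\<bar>f x\<bar> powr p)) \<in> borel_measurable borel" by measurable
    define g where "g = (\<lambda>x. f (- (1 / r) *\<^sub>R c + (1 / r) *\<^sub>R x))"
    have "{x. - (1 / r) *\<^sub>R c + (1 / r) *\<^sub>R x \<in> ?\<Omega>'} = \<Omega>"
      using r by (auto simp: algebra_simps)
    then have tg: "g \<in> test_fun \<Omega>"
      using test_fun_affine[OF f(1), of "1 / r" "- (1 / r) *\<^sub>R c"] r by (simp add: g_def)
    have Eg: "energy p g = ennreal ((1 / r) powr (p - real CARD('n))) * energy p f"
      unfolding g_def using r by (intro energy_affine sf) simp
    have Ig: "(\<integral>\<^sup>+x. ennreal (\<bar>g x\<bar> powr p) \<partial>lborel) = ennreal (r ^ CARD('n)) * ?I"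
      using nn_integral_affine[OF m, of "1 / r" "- (1 / r) *\<^sub>R c"] r by (simp add: g_def)
    show "lambda1 p \<Omega> \<le> ennreal (K * r powr (- p))"
    proof (rule lambda1_le[OF tg])
      show "0 < (\<integral>\<^sup>+x. ennreal (\<bar>g x\<bar> powr p) \<partial>lborel)"
        using f(2) r by (simp add: Ig ennreal_zero_less_mult_iff)
      have "energy p g \<le> ennreal ((1 / r) powr (p - real CARD('n))) * (ennreal K * ?I)"
        unfolding Eg by (intro mult_left_mono f(3)) simp
      also have "\<dots> = ennreal ((1 / r) powr (p - real CARD('n)) * K) * ?I"
        using K(1) by (simp add: ennreal_mult mult.assoc)
      also have "(1 / r) powr (p - real CARD('n)) * K = K * r powr (- p) * r ^ CARD('n)"
      proof -
        have "(1 / r) powr (p - real CARD('n)) = r powr (- p + real CARD('n))"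
          using r by (simp add: powr_divide flip: powr_minus_divide)
        also have "\<dots> = r powr (- p) * r ^ CARD('n)"
          using r by (simp only: powr_add powr_realpow)
        finally show ?thesis by simp
      qed
      also have "ennreal \<dots> * ?I = ennreal (K * r powr (- p)) * (ennreal (r ^ CARD('n)) * ?I)"
        using K(1) r by (simp add: ennreal_mult mult.assoc)
      finally show "energy p g \<le> ennreal (K * r powr (- p)) * (\<integral>\<^sup>+x. ennreal (\<bar>g x\<bar> powr p) \<partial>lborel)"
        by (simp only: Ig)
    qed
  qed
qed

section \<open>From single radii to the supremum\<close>

lemma ennreal_mult_neg_power:
  assumes "0 < K" "0 < \<rho>"
  shows "ennreal K * neg_power (ennreal \<rho>) p = ennreal (K * \<rho> powr (- p))"
  using assms by (simp add: neg_power_def inverse_ennreal powr_minus flip: ennreal_mult)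

lemma neg_power_zero: "0 < p \<Longrightarrow> 0 < K \<Longrightarrow> ennreal K * neg_power 0 p = top"
  by (simp add: neg_power_def ennreal_mult_top)

lemma tendsto_ennreal_powr_minus:
  assumes "0 < \<rho>"
  shows "((\<lambda>r. ennreal (K * r powr (- p))) \<longlongrightarrow> ennreal (K * \<rho> powr (- p))) (at \<rho> within S)"
  using assms by (intro tendsto_intros) auto

text \<open>For finite positive R the bound passes to the limit as r decreases to R. At R = 0 the
  left side is infinite and the bounds at small radii force \<open>l\<close> to be infinite; at R =
  \<open>top\<close> the left side is 0.\<close>

lemma mult_neg_power_le:
  assumes "0 < p" "0 < K" and *: "\<And>r. 0 < r \<Longrightarrow> R < ennreal r \<Longrightarrow> ennreal (K * r powr (- p)) \<le> l"
  shows "ennreal K * neg_power R p \<le> l"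
proof (cases R)
  case (real \<rho>)
  show ?thesis
  proof (cases "\<rho> = 0")
    case True
    have "l = top"
    proof (rule ccontr)
      assume "l \<noteq> top"
      then obtain x where x: "0 \<le> x" "l = ennreal x" by (cases l) auto
      \<comment> \<open>Solves K r^(-p) = x + 1, which exceeds the supposed finite value x of
        \<open>l\<close>.\<close>
      define r where "r = (K / (x + 1)) powr (1 / p)"
      have r: "0 < r" using assms x by (simp add: r_def)
      have "r powr (- p) = (x + 1) / K"
        using assms x by (simp add: r_def powr_powr powr_minus field_simps)
      then have "ennreal (x + 1) \<le> ennreal x"
        using *[OF r] assms r x real True by simp
      then show False using x by (simp add: ennreal_le_iff del: ennreal_plus)
    qed
    then show ?thesis by simp
  next
    case False
    then have \<rho>: "0 < \<rho>" using real by simp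
    have "ennreal (K * \<rho> powr (- p)) \<le> l"
    proof (rule tendsto_upperbound[OF tendsto_ennreal_powr_minus[OF \<rho>]])
      show "eventually (\<lambda>r. ennreal (K * r powr (- p)) \<le> l) (at_right \<rho>)"
        using eventually_at_right_less[of \<rho>]
      proof (rule eventually_mono)
        fix r assume "\<rho> < r"
        then show "ennreal (K * r powr (- p)) \<le> l"
          using \<rho> real by (intro *) (auto simp: ennreal_less_iff)
      qed
    qed simp
    then show ?thesis
      using real \<rho> assms by (simp add: ennreal_mult_neg_power)
  qed
qed (simp add: neg_power_def)

text \<open>For finite positive R let r increase to R. At R = 0 the right side is infinite; at R =
  \<open>top\<close> arbitrarily large radii are allowed and force l = 0.\<close>

lemma le_mult_neg_power:
  assumes "0 < p" "0 < K" and *: "\<And>r. 0 < r \<Longrightarrow> ennreal r < R \<Longrightarrow> l \<le> ennreal (K * r powr (- p))"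
  shows "l \<le> ennreal K * neg_power R p"
proof (cases R)
  case (real \<rho>)
  show ?thesis
  proof (cases "\<rho> = 0")
    case True
    then show ?thesis using assms real neg_power_zero[of p K] by simp
  next
    case False
    then have \<rho>: "0 < \<rho>" using real by simp
    have "l \<le> ennreal (K * \<rho> powr (- p))"
    proof (rule tendsto_lowerbound[OF tendsto_ennreal_powr_minus[OF \<rho>]])
      show "eventually (\<lambda>r. l \<le> ennreal (K * r powr (- p))) (at_left \<rho>)"
        using eventually_at_left_real[OF \<rho>]
      proof (rule eventually_mono)
        fix r assume "r \<in> {0<..<\<rho>}"
        then show "l \<le> ennreal (K * r powr (- p))"
          using real by (intro *) (auto simp: ennreal_less_iff)
      qed
    qed simp
    then show ?thesis
      using real \<rho> assms by (simp add: ennreal_mult_neg_power)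
  qed
next
  case top
  have "l \<le> 0"
  proof (rule ennreal_le_epsilon)
    fix e :: real assume e: "0 < e"
    \<comment> \<open>Solves K r^(-p) = e.\<close>
    define r where "r = (K / e) powr (1 / p)"
    have r: "0 < r" using assms e by (simp add: r_def)
    have "r powr (- p) = e / K"
      using assms e by (simp add: r_def powr_powr powr_minus field_simps)
    then show "l \<le> 0 + ennreal e"
      using *[OF r] top assms by simp
  qed
  then show ?thesis by simp
qed

theorem theorem3p1:
  fixes p \<gamma> :: real
  assumes "CARD('n::finite) > 2"
    and "0 < \<gamma>" and "\<gamma> < 1"
    and "1 < p" and "p \<le> real CARD('n)"
  shows "\<exists>K1 K2 :: real. 0 < K1 \<and> 0 < K2 \<and>
    (\<forall>\<Omega> :: (real^'n) set. open \<Omega> \<longrightarrow>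
       ennreal K1 * neg_power (capacity_radius p \<gamma> \<Omega>) p \<le> lambda1 p \<Omega> \<and>
       lambda1 p \<Omega> \<le> ennreal K2 * neg_power (capacity_radius p \<gamma> \<Omega>) p)"
proof -
  obtain K1 where K1: "0 < K1" "\<And>(\<Omega>::(real^'n) set) r u. open \<Omega> \<Longrightarrow> 0 < r \<Longrightarrow> u \<in> test_fun \<Omega> \<Longrightarrow>
    \<forall>c. \<not> negligible_in p \<gamma> c r (cball c r - \<Omega>) \<Longrightarrow>
    ennreal (K1 * r powr (- p)) * (\<integral>\<^sup>+x. ennreal (\<bar>u x\<bar> powr p) \<partial>lborel) \<le> energy p u"
    using poincare_non_negligible[OF assms(4,2), where 'n = 'n] by blast
  obtain K2 where K2: "0 < K2" "\<And>(\<Omega>::(real^'n) set) r c. open \<Omega> \<Longrightarrow> 0 < r \<Longrightarrow>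
     negligible_in p \<gamma> c r (cball c r - \<Omega>) \<Longrightarrow> lambda1 p \<Omega> \<le> ennreal (K2 * r powr (- p))"
    using lambda1_le_negligible[OF assms(4,2,3), where 'n = 'n] by blast
  show ?thesis
  proof (rule exI[of _ K1], rule exI[of _ K2], intro conjI allI impI K1(1) K2(1))
    fix \<Omega> :: "(real^'n) set"
    assume \<Omega>: "open \<Omega>"
    show "ennreal K1 * neg_power (capacity_radius p \<gamma> \<Omega>) p \<le> lambda1 p \<Omega>"
    proof (rule mult_neg_power_le)
      fix r assume r: "0 < r" "capacity_radius p \<gamma> \<Omega> < ennreal r"
      have "\<not> negligible_in p \<gamma> c r (cball c r - \<Omega>)" for c
      proof
        assume "negligible_in p \<gamma> c r (cball c r - \<Omega>)"
        then have "ennreal r \<le> capacity_radius p \<gamma> \<Omega>"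
          unfolding capacity_radius_def using r(1) by (intro Sup_upper) blast
        then show False using r(2) by simp
      qed
      then show "ennreal (K1 * r powr (- p)) \<le> lambda1 p \<Omega>"
        using assms(4) K1 \<Omega> r(1) by (intro lambda1_ge) auto
    qed (use assms K1 in auto)
    show "lambda1 p \<Omega> \<le> ennreal K2 * neg_power (capacity_radius p \<gamma> \<Omega>) p"
    proof (rule le_mult_neg_power)
      fix r assume r: "0 < r" "ennreal r < capacity_radius p \<gamma> \<Omega>"
      \<comment> \<open>Negligibility is not known to pass to smaller radii, so a larger radius
        \<open>r'\<close> is taken from the supremum and the monotonicity of r^(-p) leads back to
        \<open>r\<close>.\<close>
      then obtain r' c where r': "0 < r'" "negligible_in p \<gamma> c r' (cball c r' - \<Omega>)" "ennreal r < ennreal r'"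
        unfolding capacity_radius_def less_Sup_iff by blast
      have "lambda1 p \<Omega> \<le> ennreal (K2 * r' powr (- p))"
        by (rule K2(2)[OF \<Omega> r'(1,2)])
      also have "\<dots> \<le> ennreal (K2 * r powr (- p))"
        using r r' K2(1) assms(4) by (intro ennreal_leI mult_left_mono powr_mono2') (auto simp: ennreal_less_iff)
      finally show "lambda1 p \<Omega> \<le> ennreal (K2 * r powr (- p))" .
    qed (use assms K2 in auto)
  qed
qed

end
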